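(* Let $H$ be a separable Hilbert space and $V$ a separable Banach space. Let $\nu$ be a cylindrical probability measure on $\mathcal{Z}(H)$, let $c>0$, and let $\theta$ be the compound Poisson cylindrical distribution on $\mathcal{Z}(H)$ with characteristic function $$\varphi_\theta\colon H\to\mathbb{C},\qquad \varphi_\theta(h)=\exp\Big(c\int_H\big(e^{i\langle h,g\rangle}-1\big)\,\nu(dg)\Big).$$ Then for each $p\ge1$, $$\mathcal{R}^p(\theta)=\mathcal{R}^p(\nu),$$ where $\mathcal{R}^p(\cdot)=\mathcal{R}^p_{H,V}(\cdot)$.
   Context: All spaces are real. For a separable Banach space $V$ with dual $V^*$ and dual pairing $\langle\cdot,\cdot\rangle$, cylindrical sets are the sets $\{v\in V:(\langle v,v_1^*\rangle,\dots,\langle v,v_n^*\rangle)\in B\}$ with $n\in\mathbb{N}$, $v_i^*\in V^*$, $B\in\mathcal{B}(\mathbb{R}^n)$; they form the algebra $\mathcal{Z}(V)$. A cylindrical probability measure $\eta$ on $\mathcal{Z}(V)$ is a function $\eta\colon\mathcal{Z}(V)\to[0,\infty]$ with $\eta(V)=1$ whose restriction to the $\sigma$-algebra generated by any finite set of functionals in $V^*$ is a measure. Its characteristic function is $\varphi_\eta(v^* )=\int_Ve^{i\langle v,v^*\rangle}\,\eta(dv)$; it is assumed throughout that characteristic functions of cylindrical measures are continuous. The same definitions apply to a separable Hilbert space $H$. $\mathcal{L}(H,V)$ denotes the bounded linear operators. For a cylindrical probability measure $\theta$ on $\mathcal{Z}(H)$ and $T\in\mathcal{L}(H,V)$ the image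 cylindrical measure is $(\theta\circ T^{-1})(C)=\theta(T^{-1}(C))$, $C\in\mathcal{Z}(V)$. $T$ is $\theta$-radonifying of order $p$ if $\theta\circ T^{-1}$ extends to a probability measure on $\mathcal{B}(V)$ and the extension satisfies $\int_V\|v\|^p\,(\theta\circ T^{-1})(dv)<\infty$. $\mathcal{R}^p(\theta)=\mathcal{R}^p_{H,V}(\theta)$ is the set of all $T\in\mathcal{L}(H,V)$ that are $\theta$-radonifying of order $p$. *)

theory Defs
  imports "HOL-Probability.Probability"
begin

text \<open>
  The dual of \<open>'v\<close> is the type \<open>'v \<Rightarrow>\<^sub>L real\<close>. Separability of a normed space is
  expressed by the class \<open>second_countable_topology\<close>, to which it is equivalent for metric spaces.
  The Borel sets of \<open>R\<^sup>n\<close> are those of the \<open>n\<close>-fold product of \<open>borel\<close>, a point of \<open>R\<^sup>n\<close>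
  being an extensional function on \<open>{..<n}\<close>.
\<close>

definition cylindrical_sets :: "'v::real_normed_vector set set" where
  "cylindrical_sets =
     {C. \<exists>(n::nat) (f :: nat \<Rightarrow> 'v \<Rightarrow>\<^sub>L real) B.
           B \<in> sets (\<Pi>\<^sub>M i\<in>{..<n}. (borel :: real measure)) \<and>
           C = {v. (\<lambda>i\<in>{..<n}. blinfun_apply (f i) v) \<in> B}}"

definition functional_sigma :: "('v::real_normed_vector \<Rightarrow>\<^sub>L real) set \<Rightarrow> 'v set set" where
  "functional_sigma \<Gamma> =
     sigma_sets UNIV {blinfun_apply f -` B | f B. f \<in> \<Gamma> \<and> B \<in> sets (borel :: real measure)}"

text \<open>
  A set function on the algebra of cylindrical sets is a total function \<open>'v set \<Rightarrow> ennreal\<close>,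
  whose values outside \<^const>\<open>cylindrical_sets\<close> play no role.
  The following is its restriction to the \<open>\<sigma>\<close>-algebra generated by \<open>\<Gamma>\<close>, as a measure space.
  A function of the form \<open>\<lambda>v. F (f v)\<close> is integrated against it with \<open>\<Gamma> = {f}\<close>.
\<close>

definition cyl_restrict ::
    "('v::real_normed_vector set \<Rightarrow> ennreal) \<Rightarrow> ('v \<Rightarrow>\<^sub>L real) set \<Rightarrow> 'v measure" where
  "cyl_restrict \<eta> \<Gamma> = measure_of UNIV (functional_sigma \<Gamma>) \<eta>"

definition cyl_char ::
    "('v::real_normed_vector set \<Rightarrow> ennreal) \<Rightarrow> ('v \<Rightarrow>\<^sub>L real) \<Rightarrow> complex" where
  "cyl_char \<eta> f = (LINT v | cyl_restrict \<eta> {f}. iexp (blinfun_apply f v))"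

text \<open>Continuity of the characteristic function (in the norm of the dual) is a standing assumption.\<close>

definition cylindrical_prob :: "('v::real_normed_vector set \<Rightarrow> ennreal) \<Rightarrow> bool" where
  "cylindrical_prob \<eta> \<longleftrightarrow>
     \<eta> UNIV = 1 \<and>
     (\<forall>\<Gamma>. finite \<Gamma> \<longrightarrow> measure_space UNIV (functional_sigma \<Gamma>) \<eta>) \<and>
     continuous_on UNIV (cyl_char \<eta>)"

text \<open>
  The dual of the Hilbert space is identified with the space itself through
  \<^const>\<open>blinfun_inner_right\<close>, which sends \<open>h\<close> to the functional \<open>\<lambda>g. h \<bullet> g\<close>.
\<close>

definition compound_poisson_cylindrical ::
    "real \<Rightarrow> ('h::real_inner set \<Rightarrow> ennreal) \<Rightarrow> ('h set \<Rightarrow> ennreal) \<Rightarrow> bool" where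
  "compound_poisson_cylindrical c \<nu> \<theta> \<longleftrightarrow>
     cylindrical_prob \<theta> \<and>
     (\<forall>h. cyl_char \<theta> (blinfun_inner_right h) =
        exp (complex_of_real c *
             (LINT g | cyl_restrict \<nu> {blinfun_inner_right h}. (iexp (h \<bullet> g) - 1))))"

definition cyl_image ::
    "('h::real_normed_vector set \<Rightarrow> ennreal) \<Rightarrow> ('h \<Rightarrow>\<^sub>L 'v::real_normed_vector) \<Rightarrow> 'v set \<Rightarrow> ennreal"
  where "cyl_image \<theta> T C = \<theta> (blinfun_apply T -` C)"

definition radonifying ::
    "real \<Rightarrow> ('h::real_normed_vector set \<Rightarrow> ennreal) \<Rightarrow> ('h \<Rightarrow>\<^sub>L 'v::real_normed_vector) \<Rightarrow> bool" where
  "radonifying p \<theta> T \<longleftrightarrow>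
     (\<exists>\<mu> :: 'v measure.
        prob_space \<mu> \<and> sets \<mu> = sets borel \<and>
        (\<forall>C\<in>cylindrical_sets. emeasure \<mu> C = cyl_image \<theta> T C) \<and>
        (\<integral>\<^sup>+ v. ennreal (norm v powr p) \<partial>\<mu>) < \<infinity>)"

definition radonifying_ops ::
    "real \<Rightarrow> ('h::real_normed_vector set \<Rightarrow> ennreal) \<Rightarrow> ('h \<Rightarrow>\<^sub>L 'v::real_normed_vector) set" where
  "radonifying_ops p \<theta> = {T. radonifying p \<theta> T}"

end

theory Submission
  imports Defs
begin

text \<open>
  Fix \<open>T\<close> and let \<open>\<alpha>\<close> and \<open>\<beta>\<close> be the images of \<open>\<nu>\<close> and \<open>\<theta>\<close> under \<open>T\<close>. By the Riesz representation of
  functionals on the Hilbert space, the characteristic functions on the dual of \<open>V\<close> satisfy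
  \<open>\<phi>\<^sub>\<beta> = exp (c * (\<phi>\<^sub>\<alpha> - 1))\<close>: on every finite family of functionals, \<open>\<beta>\<close> is the compound Poisson law with
  jump law \<open>\<alpha>\<close>.

  If \<open>\<alpha>\<close> extends to a Borel probability \<open>\<mu>\<close> with finite \<open>p\<close>-th moment, then the compound Poisson law
  \<open>exp (-c) * (\<Sum>n. c ^ n / n! * \<mu>\<^sup>*\<^sup>n)\<close> is a Borel probability on \<open>V\<close> with characteristic function \<open>\<phi>\<^sub>\<beta>\<close>, so it extends \<open>\<beta>\<close>
  (\<open>compound_poisson_extends\<close>). Its \<open>p\<close>-th moment is finite since the moments of the convolution
  powers grow at most geometrically (\<open>moment_compound_poisson_finite\<close>).

  Conversely, let \<open>\<beta>\<close> extend to \<open>\<rho>\<close>. The series has nonnegative terms and contains the term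
  \<open>c * exp (-c) * \<alpha>\<close>, whence \<open>\<alpha> \<le> (exp c / c) * \<rho>\<close> on cylindrical sets
  (\<open>cylindrical_measure_le_compound_poisson\<close>). A finitely additive set function below a multiple of a
  finite measure has a bounded density with respect to it (\<open>dominated_additive_has_density\<close>). That
  density, applied to \<open>\<rho>\<close>, extends \<open>\<alpha>\<close> to a Borel measure below \<open>(exp c / c) * \<rho>\<close>, and the \<open>p\<close>-th moment
  is inherited from \<open>\<rho>\<close>.

  In both directions, measures are identified on cylindrical sets through their characteristic functions.
  The uniqueness theorem for finitely many real functions (\<open>char_determines_joint_distr\<close>) is derived from
  the one for a single real random variable.
\<close>

section \<open>Uniqueness of joint characteristic functions\<close>

text \<open>
  A finite measure that need not have total mass one: normalise \<open>a\<close> to a probability density,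
  apply Levy's theorem to the laws of \<open>X\<close> and \<open>Y\<close> under it, and scale back. Frequency \<open>s = 0\<close> says
  that the two masses agree.
\<close>

lemma Levy_uniqueness_weighted:
  fixes X :: "'a \<Rightarrow> real" and Y :: "'b \<Rightarrow> real" and a :: "'a \<Rightarrow> real" and b :: "'b \<Rightarrow> real"
  assumes X[measurable]: "X \<in> borel_measurable M" and Y[measurable]: "Y \<in> borel_measurable N"
    and a: "integrable M a" "\<And>x. 0 \<le> a x" and b: "integrable N b" "\<And>y. 0 \<le> b y"
    and eq: "\<And>s. (LINT x|M. a x *\<^sub>R iexp (s * X x)) = (LINT y|N. b y *\<^sub>R iexp (s * Y y))"
    and A[measurable]: "A \<in> sets borel"
  shows "(LINT x|M. a x * indicator A (X x)) = (LINT y|N. b y * indicator A (Y y))"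
proof -
  have [measurable]: "a \<in> borel_measurable M" "b \<in> borel_measurable N"
    using a b by auto
  define m where "m = (LINT x|M. a x)"
  have "complex_of_real m = complex_of_real (LINT y|N. b y)"
    using eq[of 0] by (simp add: m_def scaleR_conv_of_real)
  then have mb: "(LINT y|N. b y) = m" by simp
  have m0: "0 \<le> m" unfolding m_def using a by simp
  show ?thesis
  proof (cases "m = 0")
    case True
    have "AE x in M. a x = 0"
      using True a unfolding m_def by (simp add: integral_nonneg_eq_0_iff_AE)
    moreover have "AE y in N. b y = 0"
      using True b mb by (simp add: integral_nonneg_eq_0_iff_AE)
    ultimately have "(LINT x|M. a x * indicator A (X x)) = (LINT x|M. 0)"
      "(LINT y|N. b y * indicator A (Y y)) = (LINT y|N. 0)"
      by (auto intro!: integral_eq_zero_AE)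
    then show ?thesis by simp
  next
    case False
    with m0 have mp: "0 < m" by simp
    let ?P = "density M (\<lambda>x. ennreal (a x / m))"
    let ?Q = "density N (\<lambda>y. ennreal (b y / m))"
    have "emeasure ?P (space ?P) = 1"
      using a mp by (simp add: emeasure_density cong: nn_integral_cong)
        (subst nn_integral_eq_integral, auto simp: m_def)
    then interpret P: prob_space ?P by (rule prob_spaceI)
    have "emeasure ?Q (space ?Q) = 1"
      using b mp by (simp add: emeasure_density cong: nn_integral_cong)
        (subst nn_integral_eq_integral, auto simp: mb)
    then interpret Q: prob_space ?Q by (rule prob_spaceI)
    have "distr ?P borel X = distr ?Q borel Y"
    proof (rule Levy_uniqueness)
      show "real_distribution (distr ?P borel X)" "real_distribution (distr ?Q borel Y)"
        by auto
      show "char (distr ?P borel X) = char (distr ?Q borel Y)"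
      proof
        fix s
        have "char (distr ?P borel X) s = (LINT x|M. (a x / m) *\<^sub>R iexp (s * X x))"
          using a mp by (simp add: char_def integral_distr integral_density del: of_real_mult)
        also have "\<dots> = (1 / m) *\<^sub>R (LINT x|M. a x *\<^sub>R iexp (s * X x))"
          by (subst integral_scaleR_right[symmetric]) (simp add: field_simps)
        also have "\<dots> = (1 / m) *\<^sub>R (LINT y|N. b y *\<^sub>R iexp (s * Y y))"
          by (simp only: eq)
        also have "\<dots> = (LINT y|N. (b y / m) *\<^sub>R iexp (s * Y y))"
          by (subst integral_scaleR_right[symmetric]) (simp add: field_simps)
        also have "\<dots> = char (distr ?Q borel Y) s"
          using b mp by (simp add: char_def integral_distr integral_density del: of_real_mult)
        finally show "char (distr ?P borel X) s = char (distr ?Q borel Y) s" .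
      qed
    qed
    then have "(LINT x|distr ?P borel X. indicator A x :: real) = (LINT x|distr ?Q borel Y. indicator A x)"
      by simp
    then have "(LINT x|M. (a x / m) * indicator A (X x)) = (LINT y|N. (b y / m) * indicator A (Y y))"
      using a b mp by (simp add: integral_distr integral_density del: Bochner_Integration.integral_indicator integral_indicator)
    then show ?thesis
      using mp by simp
  qed
qed

text \<open>
  A complex weight \<open>h\<close> is no density, but \<open>a + Re (u * h)\<close> with \<open>\<bar>u\<bar> = 1\<close> is nonnegative, since
  \<open>a\<close> dominates \<open>\<bar>h\<bar>\<close>. Its transform is known: conjugating the transform of \<open>h\<close> at \<open>-s\<close> gives the
  transform of \<open>cnj h\<close> at \<open>s\<close>. So the positive case applies to \<open>a + Re (u * h)\<close> and to \<open>a\<close>, and the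
  difference is the real part (\<open>u = 1\<close>) or the imaginary part (\<open>u = - \<i>\<close>) of the claim.
\<close>

lemma Levy_uniqueness_complex_weight:
  fixes X :: "'a \<Rightarrow> real" and Y :: "'b \<Rightarrow> real" and a :: "'a \<Rightarrow> real" and b :: "'b \<Rightarrow> real"
    and h :: "'a \<Rightarrow> complex" and k :: "'b \<Rightarrow> complex"
  assumes X[measurable]: "X \<in> borel_measurable M" and Y[measurable]: "Y \<in> borel_measurable N"
    and a: "integrable M a" and b: "integrable N b"
    and h[measurable]: "h \<in> borel_measurable M" "\<And>x. cmod (h x) \<le> a x"
    and k[measurable]: "k \<in> borel_measurable N" "\<And>y. cmod (k y) \<le> b y"
    and eq: "\<And>s. (LINT x|M. a x *\<^sub>R iexp (s * X x)) = (LINT y|N. b y *\<^sub>R iexp (s * Y y))"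
    and eqh: "\<And>s. (LINT x|M. h x * iexp (s * X x)) = (LINT y|N. k y * iexp (s * Y y))"
    and A[measurable]: "A \<in> sets borel"
  shows "(LINT x|M. h x * indicator A (X x)) = (LINT y|N. k y * indicator A (Y y))"
proof -
  have [measurable]: "a \<in> borel_measurable M" "b \<in> borel_measurable N"
    using a b by auto
  have a0: "0 \<le> a x" and b0: "0 \<le> b y" for x y
    using h(2)[of x] k(2)[of y] norm_ge_zero order_trans by blast+
  have [measurable]: "(\<lambda>x. cnj (h x)) \<in> borel_measurable M" "(\<lambda>x. cnj (k x)) \<in> borel_measurable N"
    by (auto intro!: borel_measurable_continuous_on[of cnj] continuous_intros)
  have h2: "cmod (h x) \<le> a x * 2" and k2: "cmod (k y) \<le> b y * 2" for x y
    using h(2)[of x] k(2)[of y] a0[of x] b0[of y] by linarith+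
  have dom_a: "integrable M f"
    if "f \<in> borel_measurable M" "\<And>x. norm (f x) \<le> a x" for f :: "'a \<Rightarrow> complex"
    by (rule Bochner_Integration.integrable_bound[OF a]) (use that a0 in \<open>auto intro: order_trans\<close>)
  have dom_b: "integrable N f"
    if "f \<in> borel_measurable N" "\<And>x. norm (f x) \<le> b x" for f :: "'b \<Rightarrow> complex"
    by (rule Bochner_Integration.integrable_bound[OF b]) (use that b0 in \<open>auto intro: order_trans\<close>)
  have rdom_a: "integrable M f"
    if "f \<in> borel_measurable M" "\<And>x. \<bar>f x\<bar> \<le> a x" for f :: "'a \<Rightarrow> real"
    by (rule Bochner_Integration.integrable_bound[OF a]) (use that a0 in \<open>auto intro: order_trans\<close>)
  have rdom_b: "integrable N f"
    if "f \<in> borel_measurable N" "\<And>x. \<bar>f x\<bar> \<le> b x" for f :: "'b \<Rightarrow> real"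
    by (rule Bochner_Integration.integrable_bound[OF b]) (use that b0 in \<open>auto intro: order_trans\<close>)
  have real_part: "(LINT x|M. Re (u * h x) * indicator A (X x)) = (LINT y|N. Re (u * k y) * indicator A (Y y))"
    if u: "cmod u = 1" for u
  proof -
    have ih: "integrable M (\<lambda>x. h x * iexp (s * X x))" for s
      by (rule dom_a) (auto simp: norm_mult h)
    have ik: "integrable N (\<lambda>x. k x * iexp (s * Y x))" for s
      by (rule dom_b) (auto simp: norm_mult k)
    have conj: "(LINT x|M. cnj (h x) * iexp (s * X x)) = (LINT y|N. cnj (k y) * iexp (s * Y y))" for s
    proof -
      have "(LINT x|M. cnj (h x) * iexp (s * X x)) = (LINT x|M. cnj (h x * iexp ((-s) * X x)))"
        by (simp add: exp_cnj)
      also have "\<dots> = (LINT y|N. cnj (k y * iexp ((-s) * Y y)))"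
        by (simp only: Bochner_Integration.integral_cnj eqh)
      also have "\<dots> = (LINT y|N. cnj (k y) * iexp (s * Y y))"
        by (simp add: exp_cnj)
      finally show ?thesis .
    qed
    have bd_h: "\<bar>Re (u * h x)\<bar> \<le> a x" for x
      using abs_Re_le_cmod[of "u * h x"] h(2)[of x] u by (simp add: norm_mult)
    have bd_k: "\<bar>Re (u * k x)\<bar> \<le> b x" for x
      using abs_Re_le_cmod[of "u * k x"] k(2)[of x] u by (simp add: norm_mult)
    have Re_eq: "complex_of_real (Re (u * z)) * w = (u / 2) * (z * w) + (cnj u / 2) * (cnj z * w)" for z w
    proof -
      have "complex_of_real (Re (u * z)) = (u * z + cnj (u * z)) / 2"
        by (simp only: complex_add_cnj) simp
      then show ?thesis by (simp only:) (simp add: field_simps)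
    qed
    have eqR: "(LINT x|M. Re (u * h x) *\<^sub>R iexp (s * X x)) = (LINT y|N. Re (u * k y) *\<^sub>R iexp (s * Y y))" for s
    proof -
      have "(LINT x|M. Re (u * h x) *\<^sub>R iexp (s * X x))
        = (u / 2) * (LINT x|M. h x * iexp (s * X x)) + (cnj u / 2) * (LINT x|M. cnj (h x) * iexp (s * X x))"
        unfolding scaleR_conv_of_real Re_eq
        by (subst Bochner_Integration.integral_add)
           (auto intro!: dom_a simp: norm_mult norm_divide u h2)
      also have "\<dots> = (u / 2) * (LINT x|N. k x * iexp (s * Y x)) + (cnj u / 2) * (LINT x|N. cnj (k x) * iexp (s * Y x))"
        by (simp only: eqh conj)
      also have "\<dots> = (LINT y|N. Re (u * k y) *\<^sub>R iexp (s * Y y))"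
        unfolding scaleR_conv_of_real Re_eq
        by (subst Bochner_Integration.integral_add)
           (auto intro!: dom_b simp: norm_mult norm_divide u k2)
      finally show ?thesis .
    qed
    have "(LINT x|M. (a x + Re (u * h x)) * indicator A (X x)) = (LINT y|N. (b y + Re (u * k y)) * indicator A (Y y))"
    proof (rule Levy_uniqueness_weighted[OF X Y])
      show "integrable M (\<lambda>x. a x + Re (u * h x))"
        by (intro Bochner_Integration.integrable_add a rdom_a) (auto simp del: times_complex.simps of_real_mult simp: bd_h)
      show "integrable N (\<lambda>x. b x + Re (u * k x))"
        by (intro Bochner_Integration.integrable_add b rdom_b) (auto simp del: times_complex.simps of_real_mult simp: bd_k)
      show "0 \<le> a x + Re (u * h x)" for x using bd_h[of x] by linarith
      show "0 \<le> b x + Re (u * k x)" for x using bd_k[of x] by linarith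
      fix s
      have "(LINT x|M. (a x + Re (u * h x)) *\<^sub>R iexp (s * X x))
          = (LINT x|M. a x *\<^sub>R iexp (s * X x)) + (LINT x|M. Re (u * h x) *\<^sub>R iexp (s * X x))"
        unfolding scaleR_add_left
        by (intro Bochner_Integration.integral_add dom_a) (auto simp del: times_complex.simps of_real_mult simp: a0 bd_h)
      also have "\<dots> = (LINT x|N. b x *\<^sub>R iexp (s * Y x)) + (LINT x|N. Re (u * k x) *\<^sub>R iexp (s * Y x))"
        by (simp only: eq eqR)
      also have "\<dots> = (LINT x|N. (b x + Re (u * k x)) *\<^sub>R iexp (s * Y x))"
        unfolding scaleR_add_left
        by (intro Bochner_Integration.integral_add[symmetric] dom_b) (auto simp del: times_complex.simps of_real_mult simp: b0 bd_k)
      finally show "(LINT x|M. (a x + Re (u * h x)) *\<^sub>R iexp (s * X x)) = (LINT x|N. (b x + Re (u * k x)) *\<^sub>R iexp (s * Y x))" .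
    qed (rule A)
    moreover have "(LINT x|M. a x * indicator A (X x)) = (LINT y|N. b y * indicator A (Y y))"
      by (rule Levy_uniqueness_weighted[OF X Y a a0 b b0 eq A])
    moreover have "(LINT x|M. (a x + Re (u * h x)) * indicator A (X x))
        = (LINT x|M. a x * indicator A (X x)) + (LINT x|M. Re (u * h x) * indicator A (X x))"
      unfolding distrib_right
      by (intro Bochner_Integration.integral_add rdom_a)
         (auto simp del: times_complex.simps of_real_mult simp: a0 bd_h split: split_indicator)
    moreover have "(LINT x|N. (b x + Re (u * k x)) * indicator A (Y x))
        = (LINT x|N. b x * indicator A (Y x)) + (LINT x|N. Re (u * k x) * indicator A (Y x))"
      unfolding distrib_right
      by (intro Bochner_Integration.integral_add rdom_b)
         (auto simp del: times_complex.simps of_real_mult simp: b0 bd_k split: split_indicator)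
    ultimately show ?thesis by simp
  qed
  have iM: "integrable M (\<lambda>x. h x * indicator A (X x))"
    by (rule dom_a) (auto simp: norm_mult a0 h split: split_indicator)
  have iN: "integrable N (\<lambda>x. k x * indicator A (Y x))"
    by (rule dom_b) (auto simp: norm_mult b0 k split: split_indicator)
  show ?thesis
  proof (rule complex_eqI)
    have r: "Re (z * indicator A t) = Re (1 * z) * indicator A t"
      "Im (z * indicator A t) = Re ((-\<i>) * z) * indicator A t" for z t
      by (auto split: split_indicator)
    show "Re (LINT x|M. h x * indicator A (X x)) = Re (LINT y|N. k y * indicator A (Y y))"
      unfolding integral_Re[OF iM, symmetric] integral_Re[OF iN, symmetric] r
      by (rule real_part) simp
    show "Im (LINT x|M. h x * indicator A (X x)) = Im (LINT y|N. k y * indicator A (Y y))"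
      unfolding integral_Im[OF iM, symmetric] integral_Im[OF iN, symmetric] r
      by (rule real_part) simp
  qed
qed

text \<open>
  The multivariate uniqueness theorem from the one on the line, one coordinate at a time: an
  exponential factor in one coordinate is exchanged for the indicator of a Borel set, while the
  remaining factors act as a complex weight that is dominated by the indicators already obtained.
  The two measures may live on different spaces, which is what the comparison of a measure on a
  Banach space with a cylindrical measure needs.
\<close>

lemma char_determines_joint_distr:
  fixes f :: "nat \<Rightarrow> 'a \<Rightarrow> real" and g :: "nat \<Rightarrow> 'b \<Rightarrow> real"
  assumes M: "finite_measure M" and N: "finite_measure N"
    and f[measurable]: "\<And>i. i < n \<Longrightarrow> f i \<in> borel_measurable M"
    and g[measurable]: "\<And>i. i < n \<Longrightarrow> g i \<in> borel_measurable N"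
    and eq: "\<And>t :: nat \<Rightarrow> real. (LINT x|M. iexp (\<Sum>i<n. t i * f i x)) = (LINT y|N. iexp (\<Sum>i<n. t i * g i y))"
  shows "distr M (\<Pi>\<^sub>M i\<in>{..<n}. borel) (\<lambda>x. \<lambda>i\<in>{..<n}. f i x)
       = distr N (\<Pi>\<^sub>M i\<in>{..<n}. borel) (\<lambda>y. \<lambda>i\<in>{..<n}. g i y)" (is "?P = ?Q")
proof -
  interpret M: finite_measure M by fact
  interpret N: finite_measure N by fact
  have [measurable]: "(\<lambda>x. \<lambda>i\<in>{..<n}. f i x) \<in> M \<rightarrow>\<^sub>M (\<Pi>\<^sub>M i\<in>{..<n}. borel)"
    "(\<lambda>x. \<lambda>i\<in>{..<n}. g i x) \<in> N \<rightarrow>\<^sub>M (\<Pi>\<^sub>M i\<in>{..<n}. borel)"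
    by (auto intro!: measurable_restrict)
  \<comment> \<open>After \<open>m\<close> exchanges, the first \<open>m\<close> coordinates carry indicators and the others exponentials.\<close>
  have rect: "(LINT x|M. of_real (\<Prod>i<m. indicator (A i) (f i x)) * iexp (\<Sum>i\<in>{m..<n}. t i * f i x))
    = (LINT y|N. of_real (\<Prod>i<m. indicator (A i) (g i y)) * iexp (\<Sum>i\<in>{m..<n}. t i * g i y))"
    if "m \<le> n" and A: "\<And>i. A i \<in> sets borel" for m and A :: "nat \<Rightarrow> real set" and t
    using \<open>m \<le> n\<close>
  proof (induction m arbitrary: t)
    case 0
    show ?case using eq[of t] by (simp add: atLeast0LessThan del: of_real_sum)
  next
    case (Suc m)
    then have m: "m < n" by simp
    have [measurable]: "A i \<in> sets borel" for i by (rule A)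
    have fm[measurable]: "f i \<in> borel_measurable M" "g i \<in> borel_measurable N" if "i \<le> m" for i
      using that m by auto
    let ?wM = "\<lambda>x. \<Prod>i<m. indicator (A i) (f i x) :: real"
    let ?wN = "\<lambda>x. \<Prod>i<m. indicator (A i) (g i x) :: real"
    have w01: "0 \<le> (\<Prod>i<m. indicator (A i) (z i) :: real)" "(\<Prod>i<m. indicator (A i) (z i) :: real) \<le> 1"
      for z :: "nat \<Rightarrow> real"
      by (auto intro!: prod_nonneg prod_le_1 simp: indicator_def)
    have wm[measurable]: "?wM \<in> borel_measurable M" "?wN \<in> borel_measurable N"
      using m by (auto intro!: borel_measurable_prod borel_measurable_indicator')
    let ?uM = "\<lambda>x. iexp (\<Sum>i\<in>{Suc m..<n}. t i * f i x)"
    let ?uN = "\<lambda>x. iexp (\<Sum>i\<in>{Suc m..<n}. t i * g i x)"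
    have um[measurable]: "?uM \<in> borel_measurable M" "?uN \<in> borel_measurable N"
      by (auto intro!: borel_measurable_exp)
    \<comment> \<open>Overwriting the frequency of coordinate \<open>m\<close> turns the induction hypothesis into a statement about every \<open>s\<close>.\<close>
    have split: "(\<Sum>i\<in>{m..<n}. (r(m := s)) i * z i) = s * z m + (\<Sum>i\<in>{Suc m..<n}. r i * z i)"
      for r z :: "nat \<Rightarrow> real" and s
      using m by (subst sum.atLeast_Suc_lessThan) auto
    have step: "(LINT x|M. of_real (?wM x) * iexp (\<Sum>i\<in>{Suc m..<n}. r i * f i x) * iexp (s * f m x))
      = (LINT x|N. of_real (?wN x) * iexp (\<Sum>i\<in>{Suc m..<n}. r i * g i x) * iexp (s * g m x))" for r s
      using Suc.IH[of "r(m := s)"] m unfolding split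
      by (simp add: exp_add distrib_left mult_ac del: of_real_sum of_real_prod of_real_mult)
    have "(LINT x|M. (of_real (?wM x) * ?uM x) * indicator (A m) (f m x))
      = (LINT x|N. (of_real (?wN x) * ?uN x) * indicator (A m) (g m x))"
    proof (rule Levy_uniqueness_complex_weight)
      show "integrable M ?wM" "integrable N ?wN"
        by (auto intro!: M.integrable_const_bound[where B=1] N.integrable_const_bound[where B=1] simp: w01)
      show "cmod (of_real (?wM x) * ?uM x) \<le> ?wM x" for x
        by (simp add: norm_mult w01 del: of_real_prod of_real_sum)
      show "cmod (of_real (?wN x) * ?uN x) \<le> ?wN x" for x
        by (simp add: norm_mult w01 del: of_real_prod of_real_sum)
      show "(LINT x|M. of_real (?wM x) * ?uM x * iexp (s * f m x))
        = (LINT x|N. of_real (?wN x) * ?uN x * iexp (s * g m x))" for s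
        by (rule step)
      show "(LINT x|M. ?wM x *\<^sub>R iexp (s * f m x)) = (LINT x|N. ?wN x *\<^sub>R iexp (s * g m x))" for s
        using step[of "\<lambda>_. 0" s] by (simp add: scaleR_conv_of_real)
    qed (use m in \<open>auto intro!: borel_measurable_times borel_measurable_of_real\<close>)
    then show ?case
      by (simp add: mult_ac of_real_indicator del: of_real_sum)
  qed
  show ?thesis
  proof (rule measure_eqI_PiM_finite[where I="{..<n}" and M="\<lambda>_. borel"])
    fix A :: "nat \<Rightarrow> real set"
    assume A: "\<And>i. i \<in> {..<n} \<Longrightarrow> A i \<in> sets borel"
    define A' where "A' i = (if i < n then A i else UNIV)" for i
    have A': "A' i \<in> sets borel" for i using A by (simp add: A'_def)
    have PiA: "Pi\<^sub>E {..<n} A \<in> sets (\<Pi>\<^sub>M i\<in>{..<n}. (borel :: real measure))"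
      using A by (intro sets_PiM_I_finite) auto
    have ind: "(\<Prod>i<n. indicator (A' i) (z i) :: real) = indicator (Pi\<^sub>E {..<n} A) (\<lambda>i\<in>{..<n}. z i)"
      for z :: "nat \<Rightarrow> real"
    proof -
      have "(\<Prod>i<n. indicator (A' i) (z i) :: real) = (if \<forall>i<n. z i \<in> A i then 1 else 0)"
        by (auto simp: A'_def indicator_def intro!: prod.neutral prod_zero)
      then show ?thesis by (auto simp: indicator_def PiE_def Pi_def)
    qed
    have "complex_of_real (measure ?P (Pi\<^sub>E {..<n} A)) = complex_of_real (measure ?Q (Pi\<^sub>E {..<n} A))"
    proof -
      let ?S = "Pi\<^sub>E {..<n} A"
      have "measure ?P ?S = (LINT z|?P. indicator ?S z)" "measure ?Q ?S = (LINT z|?Q. indicator ?S z)"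
        using sets.sets_into_space[OF PiA] by (auto simp: Int_absorb2)
      moreover have "(LINT z|?P. indicator ?S z :: real) = (LINT x|M. indicator ?S (\<lambda>i\<in>{..<n}. f i x))"
        "(LINT z|?Q. indicator ?S z :: real) = (LINT x|N. indicator ?S (\<lambda>i\<in>{..<n}. g i x))"
        using PiA by (auto intro!: integral_distr simp del: Bochner_Integration.integral_indicator)
      ultimately show ?thesis
        using rect[of n A' "\<lambda>_. 0", OF order_refl A'] by (simp add: ind del: of_real_prod)
    qed
    then have "measure ?P (Pi\<^sub>E {..<n} A) = measure ?Q (Pi\<^sub>E {..<n} A)" by simp
    then show "emeasure ?P (Pi\<^sub>E {..<n} A) = emeasure ?Q (Pi\<^sub>E {..<n} A)"
      by (simp add: finite_measure.emeasure_eq_measure M.finite_measure_distr N.finite_measure_distr)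
  next
    show "range (\<lambda>_ :: nat. space (\<Pi>\<^sub>M i\<in>{..<n}. (borel :: real measure))) \<subseteq> prod_algebra {..<n} (\<lambda>_. borel)"
      by (auto simp: space_PiM intro!: prod_algebraI_finite)
    show "emeasure ?P (space (\<Pi>\<^sub>M i\<in>{..<n}. (borel :: real measure))) \<noteq> \<infinity>" for i :: nat
      by (simp add: emeasure_distr M.emeasure_eq_measure)
  qed auto
qed

section \<open>Compound Poisson distributions\<close>

primrec convolution_power :: "'a::comm_monoid_add measure \<Rightarrow> nat \<Rightarrow> 'a measure" where
  "convolution_power M 0 = return M 0"
| "convolution_power M (Suc n) = distr (M \<Otimes>\<^sub>M convolution_power M n) M (\<lambda>(x, y). x + y)"

text \<open>
  For \<open>c > 0\<close>, the law of \<open>X\<^sub>1 + \<dots> + X\<^sub>N\<close> with independent \<open>X\<^sub>i\<close> of law \<open>M\<close>, where the number \<open>N\<close> of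
  summands is independent of them and Poisson distributed with mean \<open>c\<close>.
\<close>

definition compound_poisson :: "real \<Rightarrow> 'a::comm_monoid_add measure \<Rightarrow> 'a measure" where
  "compound_poisson c M = measure_pmf (poisson_pmf c) \<bind> convolution_power M"

text \<open>
  Convolution makes sense as soon as addition is measurable. This covers the Borel sets of a separable
  normed space as well as the \<open>\<sigma>\<close>-algebra generated by finitely many functionals; a cylindrical
  measure provides a measure only on the latter.
\<close>

locale additive_prob_space = prob_space M for M :: "'a::comm_monoid_add measure" +
  assumes space_UNIV [simp]: "space M = UNIV"
    and measurable_add: "(\<lambda>(x, y). x + y) \<in> M \<Otimes>\<^sub>M M \<rightarrow>\<^sub>M M"
begin

lemma sets_convolution_power [simp, measurable_cong]: "sets (convolution_power M n) = sets M"
  by (induction n) auto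

lemma space_convolution_power [simp]: "space (convolution_power M n) = UNIV"
  using sets_eq_imp_space_eq[OF sets_convolution_power] by simp

lemma measurable_add_power [measurable]:
  "(\<lambda>(x, y). x + y) \<in> M \<Otimes>\<^sub>M convolution_power M n \<rightarrow>\<^sub>M M"
  using measurable_add by (simp cong: measurable_cong_sets sets_pair_measure_cong)

lemma prob_space_convolution_power: "prob_space (convolution_power M n)"
proof (induction n)
  case 0
  show ?case by (simp add: prob_space_return)
next
  case (Suc n)
  interpret P: prob_space "convolution_power M n" by (rule Suc)
  interpret PP: pair_prob_space M "convolution_power M n" ..
  show ?case by (simp add: PP.P.prob_space_distr)
qed

lemma nn_integral_convolution_power_Suc:
  assumes g[measurable]: "g \<in> borel_measurable M"
  shows "(\<integral>\<^sup>+z. g z \<partial>convolution_power M (Suc n)) = (\<integral>\<^sup>+x. \<integral>\<^sup>+y. g (x + y) \<partial>convolution_power M n \<partial>M)"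
proof -
  interpret P: prob_space "convolution_power M n" by (rule prob_space_convolution_power)
  have [measurable]: "(\<lambda>(x, y). g (x + y)) \<in> borel_measurable (M \<Otimes>\<^sub>M convolution_power M n)"
    using measurable_compose[OF measurable_add_power g] by (simp add: case_prod_unfold)
  show ?thesis
    by (simp add: nn_integral_distr case_prod_unfold)
       (subst P.nn_integral_fst[symmetric], auto simp: case_prod_unfold[symmetric])
qed

lemma emeasure_convolution_power_1:
  assumes A: "A \<in> sets M"
  shows "emeasure (convolution_power M 1) A = emeasure M A"
proof -
  have "emeasure (convolution_power M 1) A = (\<integral>\<^sup>+z. indicator A z \<partial>convolution_power M (Suc 0))"
    using A by (simp del: convolution_power.simps)
  also have "\<dots> = (\<integral>\<^sup>+x. \<integral>\<^sup>+y. indicator A (x + y) \<partial>convolution_power M 0 \<partial>M)"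
    using A by (subst nn_integral_convolution_power_Suc) auto
  also have "\<dots> = (\<integral>\<^sup>+x. indicator A x \<partial>M)"
  proof (intro nn_integral_cong)
    fix x
    have "(\<lambda>y. indicator A (x + y) :: ennreal) \<in> borel_measurable M"
      using A measurable_compose[OF measurable_Pair1'[of x M M] measurable_add] by simp
    then show "(\<integral>\<^sup>+y. indicator A (x + y) \<partial>convolution_power M 0) = indicator A x"
      by (simp add: nn_integral_return)
  qed
  finally show ?thesis using A by simp
qed

lemma char_convolution_power:
  fixes f :: "'a \<Rightarrow> real"
  assumes f[measurable]: "f \<in> borel_measurable M"
    and add: "\<And>x y. f (x + y) = f x + f y" and zero: "f 0 = 0"
  shows "(LINT x|convolution_power M n. iexp (f x)) = (LINT x|M. iexp (f x)) ^ n"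
proof (induction n)
  case 0
  show ?case by (simp add: integral_return zero)
next
  case (Suc n)
  interpret P: prob_space "convolution_power M n" by (rule prob_space_convolution_power)
  interpret PP: pair_prob_space M "convolution_power M n" ..
  have int: "integrable (M \<Otimes>\<^sub>M convolution_power M n) (\<lambda>(x, y). iexp (f x) * iexp (f y))"
    by (rule PP.P.integrable_const_bound[where B=1]) (auto simp: norm_mult)
  have "(LINT x|convolution_power M (Suc n). iexp (f x))
      = (LINT z|(M \<Otimes>\<^sub>M convolution_power M n). (\<lambda>(x, y). iexp (f x) * iexp (f y)) z)"
    by (simp add: integral_distr case_prod_unfold add exp_add distrib_left)
  also have "\<dots> = (LINT x|M. LINT y|convolution_power M n. iexp (f x) * iexp (f y))"
    using PP.integral_fst'[OF int] by simp
  also have "\<dots> = (LINT x|M. iexp (f x)) * (LINT y|convolution_power M n. iexp (f y))"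
    by simp
  finally show ?case by (simp add: Suc.IH)
qed

lemma measurable_convolution_power:
  "convolution_power M \<in> measure_pmf (poisson_pmf c) \<rightarrow>\<^sub>M subprob_algebra M"
proof -
  have "convolution_power M n \<in> space (subprob_algebra M)" for n
    by (simp add: space_subprob_algebra prob_space_convolution_power prob_space_imp_subprob_space)
  then show ?thesis by simp
qed

lemma sets_compound_poisson [simp, measurable_cong]: "sets (compound_poisson c M) = sets M"
  unfolding compound_poisson_def by (rule sets_bind) auto

lemma space_compound_poisson [simp]: "space (compound_poisson c M) = UNIV"
  using sets_eq_imp_space_eq[OF sets_compound_poisson] by simp

lemma prob_space_compound_poisson: "prob_space (compound_poisson c M)"
  unfolding compound_poisson_def
  by (rule measure_pmf.prob_space_bind[OF _ measurable_convolution_power])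
     (simp add: prob_space_convolution_power)

lemma nn_integral_compound_poisson:
  assumes "g \<in> borel_measurable M"
  shows "(\<integral>\<^sup>+z. g z \<partial>compound_poisson c M)
    = (\<Sum>n. ennreal (pmf (poisson_pmf c) n) * (\<integral>\<^sup>+z. g z \<partial>convolution_power M n))"
  unfolding compound_poisson_def nn_integral_bind[OF assms measurable_convolution_power]
  by (simp add: nn_integral_measure_pmf nn_integral_count_space_nat)

lemma real_integral_compound_poisson:
  fixes g :: "'a \<Rightarrow> real"
  assumes g[measurable]: "g \<in> borel_measurable M" and bd: "\<And>x. \<bar>g x\<bar> \<le> B"
  shows "(LINT z|compound_poisson c M. g z) = (LINT n|measure_pmf (poisson_pmf c). LINT z|convolution_power M n. g z)"
  unfolding compound_poisson_def
  by (rule integral_bind[OF g bd measurable_convolution_power, where B'=1])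
     (auto simp: measure_pmf.emeasure_space_1 prob_space.emeasure_space_1[OF prob_space_convolution_power, simplified])

text \<open>
  Conditioning on the number of summands, the characteristic function is
  \<open>\<Sum>n. exp (-c) * c ^ n / n! * \<phi> ^ n\<close>, an exponential series, where \<open>\<phi>\<close> is that of \<open>M\<close>.
\<close>

lemma char_compound_poisson:
  fixes f :: "'a \<Rightarrow> real"
  assumes c: "0 < c" and f[measurable]: "f \<in> borel_measurable M"
    and add: "\<And>x y. f (x + y) = f x + f y" and zero: "f 0 = 0"
  shows "(LINT x|compound_poisson c M. iexp (f x)) = exp (of_real c * ((LINT x|M. iexp (f x)) - 1))"
proof -
  let ?\<phi> = "LINT x|M. iexp (f x)"
  interpret C: prob_space "compound_poisson c M" by (rule prob_space_compound_poisson)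
  have int: "integrable (compound_poisson c M) (\<lambda>x. iexp (f x))"
    by (rule C.integrable_const_bound[where B=1]) auto
  have intn: "integrable (convolution_power M n) (\<lambda>x. iexp (f x))" for n
    by (rule finite_measure.integrable_const_bound[where B=1])
       (auto simp: prob_space_convolution_power prob_space.finite_measure)
  have "norm ?\<phi> \<le> (LINT x|M. norm (iexp (f x)))" by (rule integral_norm_bound)
  then have n\<phi>: "norm ?\<phi> \<le> 1" using prob_space by simp
  have int\<phi>: "integrable (measure_pmf (poisson_pmf c)) (\<lambda>n. ?\<phi> ^ n)"
    by (rule measure_pmf.integrable_const_bound[where B=1])
       (auto simp: norm_power n\<phi> power_le_one)
  have "(LINT x|compound_poisson c M. iexp (f x)) = (LINT n|measure_pmf (poisson_pmf c). ?\<phi> ^ n)"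
  proof (rule complex_eqI)
    have "Re (LINT x|compound_poisson c M. iexp (f x)) = (LINT x|compound_poisson c M. Re (iexp (f x)))"
      by (rule integral_Re[OF int, symmetric])
    also have "\<dots> = (LINT n|measure_pmf (poisson_pmf c). LINT x|convolution_power M n. Re (iexp (f x)))"
      by (rule real_integral_compound_poisson[where B=1]) (auto intro: order_trans[OF abs_Re_le_cmod])
    also have "\<dots> = (LINT n|measure_pmf (poisson_pmf c). Re (?\<phi> ^ n))"
      by (simp only: integral_Re[OF intn] char_convolution_power[OF f add zero])
    also have "\<dots> = Re (LINT n|measure_pmf (poisson_pmf c). ?\<phi> ^ n)"
      by (rule integral_Re[OF int\<phi>])
    finally show "Re (LINT x|compound_poisson c M. iexp (f x)) = Re (LINT n|measure_pmf (poisson_pmf c). ?\<phi> ^ n)" .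
    have "Im (LINT x|compound_poisson c M. iexp (f x)) = (LINT x|compound_poisson c M. Im (iexp (f x)))"
      by (rule integral_Im[OF int, symmetric])
    also have "\<dots> = (LINT n|measure_pmf (poisson_pmf c). LINT x|convolution_power M n. Im (iexp (f x)))"
      by (rule real_integral_compound_poisson[where B=1]) (auto intro: order_trans[OF abs_Im_le_cmod])
    also have "\<dots> = (LINT n|measure_pmf (poisson_pmf c). Im (?\<phi> ^ n))"
      by (simp only: integral_Im[OF intn] char_convolution_power[OF f add zero])
    also have "\<dots> = Im (LINT n|measure_pmf (poisson_pmf c). ?\<phi> ^ n)"
      by (rule integral_Im[OF int\<phi>])
    finally show "Im (LINT x|compound_poisson c M. iexp (f x)) = Im (LINT n|measure_pmf (poisson_pmf c). ?\<phi> ^ n)" .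
  qed
  also have "\<dots> = (LINT n|count_space UNIV. pmf (poisson_pmf c) n *\<^sub>R ?\<phi> ^ n)"
    by (simp add: measure_pmf_eq_density integral_density)
  also have "\<dots> = (\<Sum>n. pmf (poisson_pmf c) n *\<^sub>R ?\<phi> ^ n)"
    using int\<phi> by (intro integral_count_space_nat) (simp add: measure_pmf_eq_density integrable_density)
  also have "\<dots> = (\<Sum>n. exp (- of_real c) * ((of_real c * ?\<phi>) ^ n /\<^sub>R fact n))"
    using c by (simp add: pmf_poisson scaleR_conv_of_real power_mult_distrib field_simps exp_of_real[symmetric])
  also have "\<dots> = exp (- of_real c) * exp (of_real c * ?\<phi>)"
  proof -
    have e: "exp (of_real c * ?\<phi>) = (\<Sum>n. (of_real c * ?\<phi>) ^ n /\<^sub>R fact n)"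
      by (simp add: exp_def)
    show ?thesis unfolding e by (rule suminf_mult) (rule summable_exp_generic)
  qed
  also have "\<dots> = exp (of_real c * (?\<phi> - 1))"
    by (simp add: exp_add[symmetric] algebra_simps)
  finally show ?thesis .
qed

text \<open>
  A compound Poisson variable has exactly one summand with probability \<open>c * exp (-c)\<close>, and then its
  law is \<open>M\<close>. This inequality is what transfers regularity from the compound Poisson law back to its
  jump law.
\<close>

lemma emeasure_le_compound_poisson:
  assumes c: "0 < c" and A: "A \<in> sets M"
  shows "emeasure M A \<le> ennreal (exp c / c) * emeasure (compound_poisson c M) A"
proof -
  have "emeasure (compound_poisson c M) A = (\<integral>\<^sup>+z. indicator A z \<partial>compound_poisson c M)"
    using A by simp
  also have "\<dots> = (\<Sum>n. ennreal (pmf (poisson_pmf c) n) * (\<integral>\<^sup>+z. indicator A z \<partial>convolution_power M n))"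
    using A by (intro nn_integral_compound_poisson) simp
  also have "\<dots> \<ge> (\<Sum>n\<in>{1}. ennreal (pmf (poisson_pmf c) n) * (\<integral>\<^sup>+z. indicator A z \<partial>convolution_power M n))"
    by (rule sum_le_suminf) auto
  finally have "ennreal (c * exp (-c)) * emeasure M A \<le> emeasure (compound_poisson c M) A"
    using c A by (simp add: pmf_poisson emeasure_convolution_power_1[simplified One_nat_def] del: convolution_power.simps)
  then have "ennreal (exp c / c) * (ennreal (c * exp (-c)) * emeasure M A)
      \<le> ennreal (exp c / c) * emeasure (compound_poisson c M) A"
    by (rule mult_left_mono) simp
  moreover have "ennreal (exp c / c) * ennreal (c * exp (-c)) = 1"
    using c by (simp add: ennreal_mult'[symmetric] exp_minus)
  ultimately show ?thesis by (simp add: mult.assoc[symmetric])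
qed
end

lemma powr_norm_add_le:
  fixes x y :: "'a::real_normed_vector"
  assumes "p \<ge> 0"
  shows "norm (x + y) powr p \<le> 2 powr p * (norm x powr p + norm y powr p)"
proof -
  have "norm (x + y) powr p \<le> (2 * max (norm x) (norm y)) powr p"
    using assms norm_triangle_ineq[of x y] by (intro powr_mono2) auto
  also have "\<dots> = 2 powr p * max (norm x) (norm y) powr p"
    by (subst powr_mult) auto
  also have "max (norm x) (norm y) powr p \<le> norm x powr p + norm y powr p"
    by (auto simp: max_def)
  finally show ?thesis by simp
qed

lemma additive_prob_space_borel:
  fixes M :: "'a::{real_normed_vector, second_countable_topology} measure"
  assumes M: "sets M = sets borel" "prob_space M"
  shows "additive_prob_space M"
proof -
  have "(\<lambda>(x, y). x + y :: 'a) \<in> borel \<Otimes>\<^sub>M borel \<rightarrow>\<^sub>M borel"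
    by measurable
  then have "(\<lambda>(x, y). x + y) \<in> M \<Otimes>\<^sub>M M \<rightarrow>\<^sub>M M"
    using M(1) by (simp cong: measurable_cong_sets sets_pair_measure_cong)
  moreover have "space M = UNIV"
    using sets_eq_imp_space_eq[OF M(1)] by simp
  ultimately show ?thesis
    using M(2) by (simp add: additive_prob_space_def additive_prob_space_axioms_def)
qed

text \<open>
  With \<open>m\<close> the \<open>p\<close>-th moment of \<open>M\<close>, the inequality for \<open>norm (x + y) powr p\<close> bounds the \<open>p\<close>-th moment of
  the \<open>n\<close>-fold sum by \<open>K ^ n * m\<close> with \<open>K = 2 * 2 powr p\<close>. This is crude, but the factorial in the Poisson weights absorbs any
  geometric growth.
\<close>

lemma moment_compound_poisson_finite:
  fixes M :: "'a::{real_normed_vector, second_countable_topology} measure"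
  assumes M: "sets M = sets borel" "prob_space M" and c: "0 < c" and p: "p \<ge> 0"
    and fin: "(\<integral>\<^sup>+v. ennreal (norm v powr p) \<partial>M) < \<infinity>"
  shows "(\<integral>\<^sup>+v. ennreal (norm v powr p) \<partial>compound_poisson c M) < \<infinity>"
proof -
  interpret additive_prob_space M by (rule additive_prob_space_borel[OF M])
  have [measurable]: "(\<lambda>v. norm v powr p) \<in> borel_measurable M"
    by (simp add: measurable_cong_sets[OF M(1) refl])
  then have nm: "(\<lambda>v. ennreal (norm v powr p)) \<in> borel_measurable M" by measurable
  define m where "m = enn2real (\<integral>\<^sup>+v. ennreal (norm v powr p) \<partial>M)"
  have m: "(\<integral>\<^sup>+v. ennreal (norm v powr p) \<partial>M) = ennreal m" "0 \<le> m"
    using fin by (auto simp: m_def)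
  define K where "K = 2 * 2 powr p"
  have K: "1 \<le> K" using p ge_one_powr_ge_zero[of 2 p] by (simp add: K_def)
  have bound: "(\<integral>\<^sup>+v. ennreal (norm v powr p) \<partial>convolution_power M n) \<le> ennreal (K ^ n * m)" for n
  proof (induction n)
    case 0
    show ?case using m(2) by (simp add: nn_integral_return[OF _ nm])
  next
    case (Suc n)
    interpret P: prob_space "convolution_power M n" by (rule prob_space_convolution_power)
    have "(\<integral>\<^sup>+v. ennreal (norm v powr p) \<partial>convolution_power M (Suc n))
      = (\<integral>\<^sup>+x. \<integral>\<^sup>+y. ennreal (norm (x + y) powr p) \<partial>convolution_power M n \<partial>M)"
      by (rule nn_integral_convolution_power_Suc[OF nm])
    also have "\<dots> \<le> (\<integral>\<^sup>+x. \<integral>\<^sup>+y. ennreal (2 powr p) * (ennreal (norm x powr p) + ennreal (norm y powr p)) \<partial>convolution_power M n \<partial>M)"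
      using powr_norm_add_le[OF p]
      by (intro nn_integral_mono) (simp add: ennreal_mult'[symmetric] ennreal_plus[symmetric] del: ennreal_plus)
    also have "\<dots> = ennreal (2 powr p) * (ennreal m + (\<integral>\<^sup>+y. ennreal (norm y powr p) \<partial>convolution_power M n))"
      using P.emeasure_space_1 emeasure_space_1
      by (simp add: nn_integral_cmult nn_integral_add m)
    also have "\<dots> \<le> ennreal (2 powr p) * (ennreal m + ennreal (K ^ n * m))"
      by (intro mult_left_mono add_left_mono Suc.IH) simp
    also have "\<dots> = ennreal (2 powr p * (m + K ^ n * m))"
      using m(2) K by (simp add: ennreal_mult' ennreal_plus)
    also have "\<dots> \<le> ennreal (K ^ Suc n * m)"
    proof (rule ennreal_leI)
      have "m \<le> K ^ n * m"
        using m(2) K mult_right_mono[of 1 "K ^ n" m] by (simp add: one_le_power)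
      then have "m + K ^ n * m \<le> 2 * (K ^ n * m)" by linarith
      then have "2 powr p * (m + K ^ n * m) \<le> 2 powr p * (2 * (K ^ n * m))"
        by (rule mult_left_mono) simp
      then show "2 powr p * (m + K ^ n * m) \<le> K ^ Suc n * m"
        by (simp add: K_def mult_ac)
    qed
    finally show ?case .
  qed
  have "(\<integral>\<^sup>+v. ennreal (norm v powr p) \<partial>compound_poisson c M)
      = (\<Sum>n. ennreal (pmf (poisson_pmf c) n) * (\<integral>\<^sup>+v. ennreal (norm v powr p) \<partial>convolution_power M n))"
    by (rule nn_integral_compound_poisson[OF nm])
  also have "\<dots> \<le> (\<Sum>n. ennreal (exp (-c) * m * ((c * K) ^ n /\<^sub>R fact n)))"
  proof (rule suminf_le)
    fix n
    have "ennreal (pmf (poisson_pmf c) n) * (\<integral>\<^sup>+v. ennreal (norm v powr p) \<partial>convolution_power M n)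
      \<le> ennreal (pmf (poisson_pmf c) n) * ennreal (K ^ n * m)"
      by (intro mult_left_mono bound) simp
    also have "\<dots> = ennreal (exp (-c) * m * ((c * K) ^ n /\<^sub>R fact n))"
      using c m(2) K by (subst ennreal_mult[symmetric]) (auto simp: power_mult_distrib field_simps)
    finally show "ennreal (pmf (poisson_pmf c) n) * (\<integral>\<^sup>+v. ennreal (norm v powr p) \<partial>convolution_power M n)
      \<le> ennreal (exp (-c) * m * ((c * K) ^ n /\<^sub>R fact n))" .
  qed auto
  also have "\<dots> < \<infinity>"
  proof -
    have "summable (\<lambda>n. exp (-c) * m * ((c * K) ^ n /\<^sub>R fact n))"
      by (rule summable_mult[OF summable_exp_generic])
    moreover have "0 \<le> exp (-c) * m * ((c * K) ^ n /\<^sub>R fact n)" for n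
      using c m(2) K by simp
    ultimately show ?thesis by (subst suminf_ennreal2) auto
  qed
  finally show ?thesis .
qed

section \<open>Set functions dominated by a measure\<close>

text \<open>
  A finitely additive \<open>\<phi>\<close> on an algebra that lies below a multiple of a finite measure is continuous at
  the empty set, hence extends to a measure \<open>N\<close> on the generated \<open>\<sigma>\<close>-algebra by Caratheodory's theorem.
  An extension alone would only live on that \<open>\<sigma>\<close>-algebra; its Radon-Nikodym density with respect to the
  restriction of \<open>M\<close>, however, is a density for all of \<open>M\<close>, and thus yields a measure on \<open>sets M\<close>.

  To see that the extension is still dominated by \<open>K * M\<close>, the defect \<open>\<delta> = K * M - \<phi>\<close> is extended in
  the same way: the identity \<open>N + D = K * M\<close> of the extensions passes from the algebra to
  the \<open>\<sigma>\<close>-algebra, because an identity, unlike an inequality, is inherited by complements.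
\<close>

lemma dominated_additive_has_density:
  assumes M: "finite_measure M" and A: "algebra (space M) A" "A \<subseteq> sets M"
    and pos: "positive A \<phi>" and add: "additive A \<phi>"
    and dom: "\<And>a. a \<in> A \<Longrightarrow> \<phi> a \<le> K * emeasure M a" and K: "K < top"
  shows "\<exists>f\<in>borel_measurable M. (\<forall>x. f x \<le> K) \<and> (\<forall>a\<in>A. emeasure (density M f) a = \<phi> a)"
proof -
  interpret M: finite_measure M by fact
  interpret A: algebra "space M" A by fact
  let ?S = "sigma_sets (space M) A"
  have KM: "K * emeasure M a < top" for a
    using K by (simp add: ennreal_mult_less_top M.emeasure_eq_measure)
  have extend: "\<exists>\<mu>. (\<forall>a\<in>A. \<mu> a = \<psi> a) \<and> measure_space (space M) ?S \<mu>"
    if "positive A \<psi>" "additive A \<psi>" "\<And>a. a \<in> A \<Longrightarrow> \<psi> a \<le> K * emeasure M a" for \<psi> :: "'a set \<Rightarrow> ennreal"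
  proof (rule A.caratheodory_empty_continuous[OF that(1,2)])
    show "\<psi> a \<noteq> \<infinity>" if "a \<in> A" for a
      using le_less_trans[OF \<open>\<And>a. a \<in> A \<Longrightarrow> \<psi> a \<le> K * emeasure M a\<close>[OF that] KM] by auto
    fix B :: "nat \<Rightarrow> 'a set"
    assume B: "range B \<subseteq> A" "decseq B" "(\<Inter>i. B i) = {}"
    have "(\<lambda>i. emeasure M (B i)) \<longlonglongrightarrow> emeasure M (\<Inter>i. B i)"
      using B A(2) by (intro Lim_emeasure_decseq) (auto simp: M.emeasure_eq_measure)
    then have "(\<lambda>i. K * emeasure M (B i)) \<longlonglongrightarrow> K * 0"
      using B K by (intro ennreal_tendsto_cmult) auto
    then have "(\<lambda>i. K * emeasure M (B i)) \<longlonglongrightarrow> 0" by simp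
    then show "(\<lambda>i. \<psi> (B i)) \<longlonglongrightarrow> 0"
      by (rule tendsto_sandwich[OF _ _ tendsto_const, rotated 2])
         (use B that(3) in \<open>auto intro!: always_eventually\<close>)
  qed
  define \<delta> where "\<delta> a = K * emeasure M a - \<phi> a" for a
  have \<phi>\<delta>: "\<phi> a + \<delta> a = K * emeasure M a" if "a \<in> A" for a
    using dom[OF that] by (simp add: \<delta>_def add_diff_inverse_ennreal)
  have fin: "\<phi> a < top" if "a \<in> A" for a using le_less_trans[OF dom[OF that] KM] .
  have "additive A \<delta>"
    unfolding additive_def
  proof safe
    fix x y assume xy: "x \<in> A" "y \<in> A" "x \<inter> y = {}"
    have "\<phi> (x \<union> y) + \<delta> (x \<union> y) = K * emeasure M (x \<union> y)"
      using xy by (intro \<phi>\<delta>) auto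
    also have "\<dots> = (\<phi> x + \<delta> x) + (\<phi> y + \<delta> y)"
      using xy A(2) \<phi>\<delta> by (subst plus_emeasure[symmetric]) (auto simp: distrib_left)
    also have "\<dots> = \<phi> (x \<union> y) + (\<delta> x + \<delta> y)"
      using additiveD[OF add] xy by (simp add: ac_simps)
    finally show "\<delta> (x \<union> y) = \<delta> x + \<delta> y"
      using fin[OF A.Un[OF xy(1,2)]] by (auto simp: ennreal_add_left_cancel)
  qed
  moreover have "positive A \<delta>" using pos by (simp add: positive_def \<delta>_def)
  moreover have "\<delta> a \<le> K * emeasure M a" for a by (simp add: \<delta>_def diff_le_self_ennreal)
  ultimately obtain \<delta>' where \<delta>': "\<And>a. a \<in> A \<Longrightarrow> \<delta>' a = \<delta> a" "measure_space (space M) ?S \<delta>'"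
    using extend[of \<delta>] by blast
  obtain \<phi>' where \<phi>': "\<And>a. a \<in> A \<Longrightarrow> \<phi>' a = \<phi> a" "measure_space (space M) ?S \<phi>'"
    using extend[OF pos add dom] by blast
  define N where "N = measure_of (space M) A \<phi>'"
  define D where "D = measure_of (space M) A \<delta>'"
  define S where "S = sigma (space M) A"
  have sets_N[simp]: "sets N = ?S" and space_N[simp]: "space N = space M"
    and sets_D[simp]: "sets D = ?S" and space_D[simp]: "space D = space M"
    and sets_S[simp]: "sets S = ?S" and space_S[simp]: "space S = space M"
    by (simp_all add: N_def D_def S_def sets_measure_of A.space_closed)
  have N: "emeasure N a = \<phi>' a" and D: "emeasure D a = \<delta>' a" if "a \<in> ?S" for a
    using that \<phi>'(2) \<delta>'(2) A.space_closed
    by (auto simp: N_def D_def emeasure_measure_of_conv)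
  have SM: "?S \<subseteq> sets M" using A(2) by (rule sets.sigma_sets_subset)
  have sub: "subalgebra M S" by (simp add: subalgebra_def SM)
  have sum: "emeasure N a + emeasure D a = K * emeasure M a" if "a \<in> ?S" for a
    using A.Int_stable A.space_closed that
  proof (induction rule: sigma_sets_induct_disjoint)
    case (basic a)
    then show ?case using \<phi>\<delta>[of a] by (simp add: N D \<phi>' \<delta>')
  next
    case empty
    show ?case by simp
  next
    case (compl a)
    then have a: "a \<in> sets N" "a \<in> sets D" "a \<in> sets M" using SM by auto
    have top: "space M \<in> A" by (rule A.top)
    have fN: "emeasure N a + emeasure D a < top" using compl.IH KM[of a] by simp
    have "(emeasure N a + emeasure D a) + (emeasure N (space M - a) + emeasure D (space M - a))
      = (emeasure N a + emeasure N (space M - a)) + (emeasure D a + emeasure D (space M - a))"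
      by (simp add: ac_simps)
    also have "\<dots> = emeasure N (space M) + emeasure D (space M)"
    proof -
      have c: "space M - a \<in> ?S" using compl.hyps by (rule sigma_sets.Compl)
      have u: "a \<union> (space M - a) = space M" using sets.sets_into_space[OF a(3)] by auto
      show ?thesis using a c u by (simp add: plus_emeasure)
    qed
    also have "\<dots> = K * emeasure M (space M)"
      using \<phi>\<delta>[OF top] top by (simp add: N D \<phi>' \<delta>')
    also have "\<dots> = K * emeasure M a + K * emeasure M (space M - a)"
      using a sets.sets_into_space[OF a(3)]
      by (subst distrib_left[symmetric], subst plus_emeasure) (auto simp: Un_absorb1)
    also have "\<dots> = (emeasure N a + emeasure D a) + K * emeasure M (space M - a)"
      by (simp add: compl.IH)
    finally show ?case using fN by (simp only: ennreal_add_left_cancel) auto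
  next
    case (union B)
    have B: "range B \<subseteq> sets N" "range B \<subseteq> sets D" "range B \<subseteq> sets M" using union(2) SM by auto
    have "emeasure N (\<Union>i. B i) + emeasure D (\<Union>i. B i) = (\<Sum>i. emeasure N (B i)) + (\<Sum>i. emeasure D (B i))"
      using B union(1) by (simp add: suminf_emeasure)
    also have "\<dots> = (\<Sum>i. emeasure N (B i) + emeasure D (B i))" by (rule suminf_add) auto
    also have "\<dots> = (\<Sum>i. K * emeasure M (B i))" using union by simp
    also have "\<dots> = K * emeasure M (\<Union>i. B i)"
      using B union(1) by (simp add: suminf_emeasure)
    finally show ?case .
  qed
  define R where "R = restr_to_subalg M S"
  have sets_R[simp]: "sets R = ?S" and space_R[simp]: "space R = space M"
    by (simp_all add: R_def sets_restr_to_subalg[OF sub] space_restr_to_subalg)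
  have R: "emeasure R a = emeasure M a" if "a \<in> ?S" for a
    using emeasure_restr_to_subalg[OF sub] that by (simp add: R_def)
  have NR: "emeasure N a \<le> K * emeasure R a" if "a \<in> ?S" for a
    using sum[OF that] R[OF that] by (metis le_iff_add)
  interpret R: finite_measure R
    unfolding R_def by (rule finite_measure_restr_to_subalg[OF sub M])
  have "absolutely_continuous R N"
    unfolding absolutely_continuous_def using NR by (fastforce simp: null_sets_def)
  then obtain f where f[measurable]: "f \<in> borel_measurable R" and fN: "density R f = N"
    using R.Radon_Nikodym[of N] by auto
  \<comment> \<open>Truncation at \<open>K\<close> leaves the density unchanged almost everywhere, because \<open>N \<le> K * R\<close>; it makes the bound hold everywhere.\<close>
  define g where "g x = min (f x) K" for x
  have g[measurable]: "g \<in> borel_measurable R" unfolding g_def by measurable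
  have "borel_measurable R = borel_measurable S" by (rule measurable_cong_sets) simp_all
  with g have gS: "g \<in> borel_measurable S" by blast
  have Na: "(\<integral>\<^sup>+x. g x * indicator a x \<partial>R) = emeasure N a" if a: "a \<in> ?S" for a
  proof (rule antisym)
    have aR[measurable]: "a \<in> sets R" using a by simp
    have dens: "emeasure N b = (\<integral>\<^sup>+x. f x * indicator b x \<partial>R)" if "b \<in> sets R" for b
      using that by (subst fN[symmetric]) (simp add: emeasure_density)
    show "(\<integral>\<^sup>+x. g x * indicator a x \<partial>R) \<le> emeasure N a"
      unfolding dens[OF aR] by (intro nn_integral_mono) (auto simp: g_def split: split_indicator)
    let ?E = "{x \<in> space R. K < f x}"
    have E[measurable]: "?E \<in> sets R" by measurable
    have aER: "a \<inter> ?E \<in> sets R" "a - ?E \<in> sets R" by measurable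
    then have aE: "a \<inter> ?E \<in> sets N" "a - ?E \<in> sets N" by simp_all
    have "emeasure N a = emeasure N (a \<inter> ?E) + emeasure N (a - ?E)"
      by (subst plus_emeasure[OF aE]) (auto intro!: arg_cong[where f="emeasure N"] simp del: space_R)
    also have "\<dots> \<le> K * emeasure R (a \<inter> ?E) + (\<integral>\<^sup>+x. f x * indicator (a - ?E) x \<partial>R)"
    proof (rule add_mono)
      show "emeasure N (a \<inter> ?E) \<le> K * emeasure R (a \<inter> ?E)" using aE(1) by (intro NR) simp
      show "emeasure N (a - ?E) \<le> (\<integral>\<^sup>+x. f x * indicator (a - ?E) x \<partial>R)"
        by (rule eq_refl) (rule dens[OF aER(2)])
    qed
    also have "\<dots> = (\<integral>\<^sup>+x. K * indicator (a \<inter> ?E) x + f x * indicator (a - ?E) x \<partial>R)"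
    proof -
      have "(\<lambda>x. K * indicator (a \<inter> ?E) x) \<in> borel_measurable R"
        "(\<lambda>x. f x * indicator (a - ?E) x) \<in> borel_measurable R"
        by (intro borel_measurable_times_ennreal borel_measurable_indicator borel_measurable_const f aER)+
      then show ?thesis
        by (simp only: nn_integral_add nn_integral_cmult_indicator[OF aER(1)])
    qed
    also have "\<dots> = (\<integral>\<^sup>+x. g x * indicator a x \<partial>R)"
      by (intro nn_integral_cong) (auto simp: g_def min_def split: split_indicator)
    finally show "emeasure N a \<le> (\<integral>\<^sup>+x. g x * indicator a x \<partial>R)" .
  qed
  have gM: "g \<in> borel_measurable M" by (rule measurable_from_subalg[OF sub gS])
  have "emeasure (density M g) a = \<phi> a" if a: "a \<in> A" for a
  proof -
    have aS: "a \<in> ?S" using a by (rule sigma_sets.Basic)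
    have "emeasure (density M g) a = (\<integral>\<^sup>+x. g x * indicator a x \<partial>M)"
      using gM aS SM by (intro emeasure_density) auto
    also have "\<dots> = (\<integral>\<^sup>+x. g x * indicator a x \<partial>R)"
      unfolding R_def using gS aS by (intro nn_integral_subalgebra2[OF sub, symmetric] borel_measurable_times_ennreal borel_measurable_indicator) simp_all
    finally show ?thesis using Na[OF aS] N[OF aS] \<phi>'(1)[OF a] by simp
  qed
  then show ?thesis using gM by (intro bexI[of _ g]) (auto simp: g_def)
qed

section \<open>Cylindrical measures\<close>

text \<open>
  The measure-theoretic part of \<open>cylindrical_prob\<close>. It is inherited by images under bounded operators
  because preimages of cylindrical sets are cylindrical.
\<close>

definition cylindrical_measure :: "('v::real_normed_vector set \<Rightarrow> ennreal) \<Rightarrow> bool" where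
  "cylindrical_measure \<eta> \<longleftrightarrow>
     \<eta> UNIV = 1 \<and> (\<forall>\<Gamma>. finite \<Gamma> \<longrightarrow> measure_space UNIV (functional_sigma \<Gamma>) \<eta>)"

lemma sigma_sets_functional_sigma [simp]:
  "sigma_sets UNIV (functional_sigma \<Gamma>) = functional_sigma \<Gamma>"
  unfolding functional_sigma_def by (rule sigma_sets_sigma_sets_eq) auto

lemma sets_cyl_restrict [simp, measurable_cong]: "sets (cyl_restrict \<eta> \<Gamma>) = functional_sigma \<Gamma>"
  by (simp add: cyl_restrict_def sets_measure_of)

lemma space_cyl_restrict [simp]: "space (cyl_restrict \<eta> \<Gamma>) = UNIV"
  by (simp add: cyl_restrict_def space_measure_of)

lemma emeasure_cyl_restrict:
  assumes "measure_space UNIV (functional_sigma \<Gamma>) \<eta>" "A \<in> functional_sigma \<Gamma>"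
  shows "emeasure (cyl_restrict \<eta> \<Gamma>) A = \<eta> A"
  using assms by (simp add: cyl_restrict_def emeasure_measure_of_conv)

lemma UNIV_in_functional_sigma [simp]: "UNIV \<in> functional_sigma \<Gamma>"
  unfolding functional_sigma_def by (rule sigma_sets_top)

lemma vimage_in_functional_sigma:
  assumes "f \<in> \<Gamma>" "B \<in> sets borel"
  shows "blinfun_apply f -` B \<in> functional_sigma \<Gamma>"
  using assms unfolding functional_sigma_def by blast

lemma measurable_cyl_restrict:
  assumes "f \<in> \<Gamma>"
  shows "blinfun_apply f \<in> borel_measurable (cyl_restrict \<eta> \<Gamma>)"
  using assms by (auto intro!: measurableI vimage_in_functional_sigma)

lemma functional_sigma_mono: "\<Gamma> \<subseteq> \<Delta> \<Longrightarrow> functional_sigma \<Gamma> \<subseteq> functional_sigma \<Delta>"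
  unfolding functional_sigma_def by (rule sigma_sets_mono') blast

lemma cylinder_in_functional_sigma:
  assumes "B \<in> sets (\<Pi>\<^sub>M i\<in>{..<n}. (borel :: real measure))"
  shows "{v. (\<lambda>i\<in>{..<n}. blinfun_apply (f i) v) \<in> B} \<in> functional_sigma (f ` {..<n})"
proof -
  let ?N = "cyl_restrict (\<lambda>_. 0) (f ` {..<n})"
  have "(\<lambda>v. \<lambda>i\<in>{..<n}. blinfun_apply (f i) v) \<in> ?N \<rightarrow>\<^sub>M (\<Pi>\<^sub>M i\<in>{..<n}. borel)"
    by (auto intro!: measurable_restrict measurable_cyl_restrict)
  from measurable_sets[OF this assms] show ?thesis by (simp add: vimage_def)
qed

lemma functional_sigma_subset_cylindrical_sets:
  assumes "finite \<Gamma>"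
  shows "functional_sigma \<Gamma> \<subseteq> cylindrical_sets"
proof -
  obtain n :: nat and f where \<Gamma>: "\<Gamma> = f ` {..<n}"
    using assms by (auto simp: finite_conv_nat_seg_image lessThan_def)
  let ?F = "\<lambda>v. \<lambda>i\<in>{..<n}. blinfun_apply (f i) v"
  let ?V = "vimage_algebra UNIV ?F (\<Pi>\<^sub>M i\<in>{..<n}. (borel :: real measure))"
  have V: "sets ?V = {?F -` B \<inter> UNIV | B. B \<in> sets (\<Pi>\<^sub>M i\<in>{..<n}. borel)}"
    by (rule sets_vimage_algebra2) (auto simp: space_PiM)
  have "blinfun_apply (f i) -` B \<in> sets ?V" if "i < n" "B \<in> sets borel" for i B
  proof -
    have "(\<lambda>x. x i) -` B \<inter> space (\<Pi>\<^sub>M i\<in>{..<n}. borel) \<in> sets (\<Pi>\<^sub>M i\<in>{..<n}. (borel :: real measure))"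
      using that by (intro measurable_sets[OF measurable_component_singleton]) auto
    moreover have "blinfun_apply (f i) -` B = ?F -` ((\<lambda>x. x i) -` B \<inter> space (\<Pi>\<^sub>M i\<in>{..<n}. borel)) \<inter> UNIV"
      using that by (auto simp: space_PiM)
    ultimately show ?thesis unfolding V by blast
  qed
  then have "functional_sigma \<Gamma> \<subseteq> sets ?V"
    unfolding functional_sigma_def \<Gamma>
    by (intro sets.sigma_sets_subset[of _ ?V, simplified]) auto
  moreover have "?F -` B \<inter> UNIV \<in> cylindrical_sets" if "B \<in> sets (\<Pi>\<^sub>M i\<in>{..<n}. borel)" for B
    using that unfolding cylindrical_sets_def by (auto simp: vimage_def)
  ultimately show ?thesis unfolding V by blast
qed

text \<open>
  The \<open>\<sigma>\<close>-algebras of finite sets of functionals form a directed family with union the cylindrical sets.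
  So everything that concerns finitely many cylindrical sets happens in a single measure space.
\<close>

lemma cylindrical_sets_iff: "C \<in> cylindrical_sets \<longleftrightarrow> (\<exists>\<Gamma>. finite \<Gamma> \<and> C \<in> functional_sigma \<Gamma>)"
proof
  assume "C \<in> cylindrical_sets"
  then obtain n f B where "B \<in> sets (\<Pi>\<^sub>M i\<in>{..<n::nat}. (borel :: real measure))"
    "C = {v. (\<lambda>i\<in>{..<n}. blinfun_apply (f i) v) \<in> B}"
    unfolding cylindrical_sets_def by blast
  then have "finite (f ` {..<n})" "C \<in> functional_sigma (f ` {..<n})"
    by (simp_all add: cylinder_in_functional_sigma)
  then show "\<exists>\<Gamma>. finite \<Gamma> \<and> C \<in> functional_sigma \<Gamma>" by blast
qed (use functional_sigma_subset_cylindrical_sets in blast)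

lemma algebra_cylindrical_sets: "algebra UNIV cylindrical_sets"
proof -
  have compl: "UNIV - C \<in> functional_sigma \<Gamma>" if "C \<in> functional_sigma \<Gamma>" for C :: "'a set" and \<Gamma>
    using that unfolding functional_sigma_def by (rule sigma_sets.Compl)
  have un: "C \<union> D \<in> functional_sigma (\<Gamma> \<union> \<Delta>)"
    if "C \<in> functional_sigma \<Gamma>" "D \<in> functional_sigma \<Delta>" for C D :: "'a set" and \<Gamma> \<Delta>
  proof -
    have "C \<in> functional_sigma (\<Gamma> \<union> \<Delta>)" "D \<in> functional_sigma (\<Gamma> \<union> \<Delta>)"
      using that functional_sigma_mono[of \<Gamma> "\<Gamma> \<union> \<Delta>"] functional_sigma_mono[of \<Delta> "\<Gamma> \<union> \<Delta>"] by auto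
    then show ?thesis unfolding functional_sigma_def by (rule sigma_sets_Un)
  qed
  have empty: "({} :: 'a set) \<in> functional_sigma {}"
    unfolding functional_sigma_def by (rule sigma_sets.Empty)
  have "({} :: 'a set) \<in> cylindrical_sets"
    using empty finite.emptyI cylindrical_sets_iff by metis
  moreover have "UNIV - C \<in> cylindrical_sets" if "C \<in> cylindrical_sets" for C :: "'a set"
    using that compl cylindrical_sets_iff by metis
  moreover have "C \<union> D \<in> cylindrical_sets"
    if "C \<in> cylindrical_sets" "D \<in> cylindrical_sets" for C D :: "'a set"
    using that un finite_UnI cylindrical_sets_iff by metis
  ultimately show ?thesis by (simp add: algebra_iff_Un)
qed

lemma measurable_blinfun_apply_borel [measurable]:
  "blinfun_apply f \<in> borel_measurable borel"
  by (intro borel_measurable_continuous_onI linear_continuous_on blinfun.bounded_linear_right)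

lemma cylindrical_sets_subset_borel: "cylindrical_sets \<subseteq> sets borel"
proof -
  have "functional_sigma \<Gamma> \<subseteq> sets borel" for \<Gamma> :: "('a \<Rightarrow>\<^sub>L real) set"
    unfolding functional_sigma_def
    using measurable_sets[OF measurable_blinfun_apply_borel]
    by (intro sets.sigma_sets_subset[of _ borel, simplified]) auto
  then show ?thesis using cylindrical_sets_iff by blast
qed

text \<open>
  The characteristic function at \<open>f\<close> depends only on the law of \<open>f\<close>. It can therefore be computed on any
  measure space with a function \<open>X\<close> that has this law, rather than on the \<open>\<sigma>\<close>-algebra of \<open>f\<close> alone.
\<close>

lemma cyl_char_eq:
  assumes \<eta>: "measure_space UNIV (functional_sigma {f}) \<eta>"
    and X[measurable]: "X \<in> borel_measurable M"
    and eq: "\<And>B. B \<in> sets borel \<Longrightarrow> emeasure M (X -` B \<inter> space M) = \<eta> (blinfun_apply f -` B)"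
  shows "(LINT x|M. iexp (X x)) = cyl_char \<eta> f"
proof -
  have f[measurable]: "blinfun_apply f \<in> borel_measurable (cyl_restrict \<eta> {f})"
    by (rule measurable_cyl_restrict) simp
  have "distr M borel X = distr (cyl_restrict \<eta> {f}) borel (blinfun_apply f)"
    by (rule measure_eqI)
       (auto simp: emeasure_distr eq emeasure_cyl_restrict[OF \<eta>] vimage_in_functional_sigma)
  then have "(LINT x|distr M borel X. iexp x) = (LINT x|distr (cyl_restrict \<eta> {f}) borel (blinfun_apply f). iexp x)"
    by simp
  then show ?thesis by (simp add: integral_distr cyl_char_def)
qed

lemma cylindrical_measure_space:
  "cylindrical_measure \<eta> \<Longrightarrow> finite \<Gamma> \<Longrightarrow> measure_space UNIV (functional_sigma \<Gamma>) \<eta>"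
  by (simp add: cylindrical_measure_def)

lemma prob_space_cyl_restrict:
  "cylindrical_measure \<eta> \<Longrightarrow> finite \<Gamma> \<Longrightarrow> prob_space (cyl_restrict \<eta> \<Gamma>)"
  by (auto intro!: prob_spaceI simp: emeasure_cyl_restrict cylindrical_measure_def)

lemma cyl_char_eq_integral_cyl_restrict:
  assumes \<eta>: "cylindrical_measure \<eta>" and \<Gamma>: "finite \<Gamma>"
    and g: "blinfun_apply g \<in> borel_measurable (cyl_restrict \<eta> \<Gamma>)"
  shows "(LINT v|cyl_restrict \<eta> \<Gamma>. iexp (blinfun_apply g v)) = cyl_char \<eta> g"
proof (rule cyl_char_eq[OF cylindrical_measure_space[OF \<eta>] g])
  fix B :: "real set" assume "B \<in> sets borel"
  then show "emeasure (cyl_restrict \<eta> \<Gamma>) (blinfun_apply g -` B \<inter> space (cyl_restrict \<eta> \<Gamma>)) = \<eta> (blinfun_apply g -` B)"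
    using measurable_sets[OF g] by (simp add: emeasure_cyl_restrict[OF cylindrical_measure_space[OF \<eta> \<Gamma>]])
qed simp

text \<open>
  The linear combinations of the \<open>f i\<close> are again functionals, so the characteristic function
  of a cylindrical measure contains the joint characteristic function of any finite family.
\<close>

lemma cylindrical_measure_determined_by_char:
  fixes f :: "nat \<Rightarrow> 'v::real_normed_vector \<Rightarrow>\<^sub>L real"
  assumes \<eta>: "cylindrical_measure \<eta>" and M: "finite_measure M" "space M = UNIV"
    and f: "\<And>i. i < n \<Longrightarrow> blinfun_apply (f i) \<in> borel_measurable M"
    and eq: "\<And>t :: nat \<Rightarrow> real. (LINT v|M. iexp (blinfun_apply (\<Sum>i<n. t i *\<^sub>R f i) v)) = cyl_char \<eta> (\<Sum>i<n. t i *\<^sub>R f i)"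
    and B: "B \<in> sets (\<Pi>\<^sub>M i\<in>{..<n}. (borel :: real measure))"
  shows "emeasure M {v. (\<lambda>i\<in>{..<n}. blinfun_apply (f i) v) \<in> B} = \<eta> {v. (\<lambda>i\<in>{..<n}. blinfun_apply (f i) v) \<in> B}"
proof -
  let ?N = "cyl_restrict \<eta> (f ` {..<n})"
  let ?F = "\<lambda>v. \<lambda>i\<in>{..<n}. blinfun_apply (f i) v"
  have fN[measurable]: "blinfun_apply (f i) \<in> borel_measurable ?N" if "i < n" for i
    using that by (intro measurable_cyl_restrict) simp
  have apply_sum: "blinfun_apply (\<Sum>i<n. t i *\<^sub>R f i) v = (\<Sum>i<n. t i * blinfun_apply (f i) v)" for t v
    by (simp add: blinfun.sum_left blinfun.scaleR_left)
  have comb: "blinfun_apply (\<Sum>i<n. t i *\<^sub>R f i) \<in> borel_measurable ?N" for t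
    unfolding apply_sum[abs_def] by measurable
  have F: "?F \<in> M \<rightarrow>\<^sub>M (\<Pi>\<^sub>M i\<in>{..<n}. borel)" "?F \<in> ?N \<rightarrow>\<^sub>M (\<Pi>\<^sub>M i\<in>{..<n}. borel)"
    using f fN by (auto intro!: measurable_restrict)
  have "distr M (\<Pi>\<^sub>M i\<in>{..<n}. borel) ?F = distr ?N (\<Pi>\<^sub>M i\<in>{..<n}. borel) ?F"
  proof (rule char_determines_joint_distr[OF M(1) _ f fN])
    show "finite_measure ?N"
      using prob_space_cyl_restrict[OF \<eta>] by (simp add: prob_space.finite_measure)
    show "(LINT x|M. iexp (\<Sum>i<n. t i * blinfun_apply (f i) x)) = (LINT y|?N. iexp (\<Sum>i<n. t i * blinfun_apply (f i) y))" for t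
      using eq[of t] cyl_char_eq_integral_cyl_restrict[OF \<eta> _ comb[of t]]
      unfolding apply_sum by (simp del: of_real_sum)
  qed
  then have "emeasure (distr M (\<Pi>\<^sub>M i\<in>{..<n}. borel) ?F) B = emeasure (distr ?N (\<Pi>\<^sub>M i\<in>{..<n}. borel) ?F) B"
    by simp
  then have "emeasure M (?F -` B) = emeasure ?N (?F -` B)"
    using F B M(2) by (simp add: emeasure_distr)
  also have "\<dots> = \<eta> (?F -` B)"
    using cylinder_in_functional_sigma[OF B, of f] cylindrical_measure_space[OF \<eta>]
    by (intro emeasure_cyl_restrict) (auto simp: vimage_def)
  finally show ?thesis by (simp add: vimage_def)
qed

lemma vimage_functional_sigma:
  fixes T :: "'h::real_normed_vector \<Rightarrow>\<^sub>L 'v::real_normed_vector"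
  assumes "A \<in> functional_sigma \<Gamma>"
  shows "blinfun_apply T -` A \<in> functional_sigma ((\<lambda>f. f o\<^sub>L T) ` \<Gamma>)"
proof -
  have "blinfun_apply T \<in> cyl_restrict (\<lambda>_. 0) ((\<lambda>f. f o\<^sub>L T) ` \<Gamma>) \<rightarrow>\<^sub>M cyl_restrict (\<lambda>_. 0) \<Gamma>"
  proof (rule measurable_sigma_sets)
    show "sets (cyl_restrict (\<lambda>_. 0) \<Gamma>) = sigma_sets UNIV {blinfun_apply f -` B | f B. f \<in> \<Gamma> \<and> B \<in> sets borel}"
      by (simp add: functional_sigma_def)
    fix A assume "A \<in> {blinfun_apply f -` B | f B. f \<in> \<Gamma> \<and> B \<in> sets (borel :: real measure)}"
    then obtain f B where A: "A = blinfun_apply f -` B" "f \<in> \<Gamma>" "B \<in> sets (borel :: real measure)" by blast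
    have "blinfun_apply T -` A = blinfun_apply (f o\<^sub>L T) -` B" by (auto simp: A(1))
    then show "blinfun_apply T -` A \<inter> space (cyl_restrict (\<lambda>_. 0) ((\<lambda>f. f o\<^sub>L T) ` \<Gamma>))
        \<in> sets (cyl_restrict (\<lambda>_. 0) ((\<lambda>f. f o\<^sub>L T) ` \<Gamma>))"
      using A by (auto intro!: vimage_in_functional_sigma)
  qed auto
  from measurable_sets[OF this, of A] assms show ?thesis by simp
qed

lemma cylindrical_measure_cyl_image:
  assumes \<eta>: "cylindrical_measure \<eta>"
  shows "cylindrical_measure (cyl_image \<eta> T)"
  unfolding cylindrical_measure_def
proof safe
  show "cyl_image \<eta> T UNIV = 1" using \<eta> by (simp add: cylindrical_measure_def cyl_image_def)
  fix \<Gamma> :: "('b \<Rightarrow>\<^sub>L real) set" assume \<Gamma>: "finite \<Gamma>"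
  let ?\<Delta> = "(\<lambda>f. f o\<^sub>L T) ` \<Gamma>"
  have m: "measure_space UNIV (functional_sigma ?\<Delta>) \<eta>"
    using \<Gamma> by (intro cylindrical_measure_space[OF \<eta>]) simp
  have S: "sigma_algebra UNIV (functional_sigma \<Gamma>)"
    unfolding functional_sigma_def by (rule sigma_algebra_sigma_sets) simp
  have "countably_additive (functional_sigma \<Gamma>) (cyl_image \<eta> T)"
  proof (rule countably_additiveI)
    fix A :: "nat \<Rightarrow> 'b set"
    assume A: "range A \<subseteq> functional_sigma \<Gamma>" "disjoint_family A" "\<Union> (range A) \<in> functional_sigma \<Gamma>"
    have "range (\<lambda>i. blinfun_apply T -` A i) \<subseteq> functional_sigma ?\<Delta>"
      using A(1) vimage_functional_sigma by fastforce
    moreover have "disjoint_family (\<lambda>i. blinfun_apply T -` A i)"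
      using A(2) by (fastforce simp: disjoint_family_on_def)
    moreover have "(\<Union>i. blinfun_apply T -` A i) \<in> functional_sigma ?\<Delta>"
      using vimage_functional_sigma[OF A(3), of T] by (simp add: vimage_Union)
    ultimately have "(\<Sum>i. \<eta> (blinfun_apply T -` A i)) = \<eta> (\<Union>i. blinfun_apply T -` A i)"
      using m unfolding measure_space_def countably_additive_def by blast
    then show "(\<Sum>i. cyl_image \<eta> T (A i)) = cyl_image \<eta> T (\<Union> (range A))"
      by (simp add: cyl_image_def vimage_Union)
  qed
  moreover have "positive (functional_sigma \<Gamma>) (cyl_image \<eta> T)"
    using m by (simp add: measure_space_def positive_def cyl_image_def)
  ultimately show "measure_space UNIV (functional_sigma \<Gamma>) (cyl_image \<eta> T)"
    using S by (simp add: measure_space_def)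
qed

lemma cyl_char_cyl_image:
  assumes \<eta>: "cylindrical_measure \<eta>"
  shows "cyl_char (cyl_image \<eta> T) f = cyl_char \<eta> (f o\<^sub>L T)"
proof -
  let ?g = "f o\<^sub>L T"
  have m: "measure_space UNIV (functional_sigma {?g}) \<eta>" by (rule cylindrical_measure_space[OF \<eta>]) simp
  have "(LINT x|cyl_restrict \<eta> {?g}. iexp (blinfun_apply ?g x)) = cyl_char (cyl_image \<eta> T) f"
  proof (rule cyl_char_eq)
    show "measure_space UNIV (functional_sigma {f}) (cyl_image \<eta> T)"
      by (rule cylindrical_measure_space[OF cylindrical_measure_cyl_image[OF \<eta>]]) simp
    show "blinfun_apply ?g \<in> borel_measurable (cyl_restrict \<eta> {?g})" by (rule measurable_cyl_restrict) simp
    fix B :: "real set" assume "B \<in> sets borel"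
    then have "emeasure (cyl_restrict \<eta> {?g}) (blinfun_apply ?g -` B) = \<eta> (blinfun_apply ?g -` B)"
      by (intro emeasure_cyl_restrict[OF m] vimage_in_functional_sigma) auto
    moreover have "blinfun_apply ?g -` B = blinfun_apply T -` blinfun_apply f -` B" by auto
    ultimately show "emeasure (cyl_restrict \<eta> {?g}) (blinfun_apply ?g -` B \<inter> space (cyl_restrict \<eta> {?g}))
        = cyl_image \<eta> T (blinfun_apply f -` B)" by (simp add: cyl_image_def)
  qed
  then show ?thesis by (simp add: cyl_char_def)
qed

section \<open>Comparison of a cylindrical measure with its compound Poisson law\<close>

lemma additive_prob_space_cyl_restrict:
  assumes \<eta>: "cylindrical_measure \<eta>" and \<Gamma>: "finite \<Gamma>"
  shows "additive_prob_space (cyl_restrict \<eta> \<Gamma>)"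
proof -
  let ?M = "cyl_restrict \<eta> \<Gamma>"
  have "(\<lambda>(x, y). x + y) \<in> ?M \<Otimes>\<^sub>M ?M \<rightarrow>\<^sub>M ?M"
  proof (rule measurable_sigma_sets)
    show "sets ?M = sigma_sets UNIV {blinfun_apply f -` B | f B. f \<in> \<Gamma> \<and> B \<in> sets borel}"
      by (simp add: functional_sigma_def)
    fix A assume "A \<in> {blinfun_apply f -` B | f B. f \<in> \<Gamma> \<and> B \<in> sets (borel :: real measure)}"
    then obtain f B where A: "A = blinfun_apply f -` B" "f \<in> \<Gamma>" and [measurable]: "B \<in> sets (borel :: real measure)" by blast
    have [measurable]: "blinfun_apply f \<in> borel_measurable ?M" using A(2) by (rule measurable_cyl_restrict)
    have "(\<lambda>z. blinfun_apply f (fst z) + blinfun_apply f (snd z)) -` B \<inter> space (?M \<Otimes>\<^sub>M ?M) \<in> sets (?M \<Otimes>\<^sub>M ?M)"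
      by measurable
    moreover have "(\<lambda>(x, y). x + y) -` A = (\<lambda>z. blinfun_apply f (fst z) + blinfun_apply f (snd z)) -` B"
      by (auto simp: A(1) blinfun.add_right)
    ultimately show "(\<lambda>(x, y). x + y) -` A \<inter> space (?M \<Otimes>\<^sub>M ?M) \<in> sets (?M \<Otimes>\<^sub>M ?M)" by simp
  qed auto
  then show ?thesis
    using prob_space_cyl_restrict[OF \<eta> \<Gamma>]
    by (simp add: additive_prob_space_def additive_prob_space_axioms_def)
qed

text \<open>
  On the \<open>\<sigma>\<close>-algebra of finitely many functionals, \<open>\<beta>\<close> is the compound Poisson law of \<open>\<alpha>\<close>,
  as the characteristic functions coincide. Hence the bound by the event of exactly one summand holds for
  cylindrical sets, with a constant that does not depend on the functionals.
\<close>

lemma cylindrical_measure_le_compound_poisson: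
  assumes \<alpha>: "cylindrical_measure \<alpha>" and \<beta>: "cylindrical_measure \<beta>" and c: "0 < c"
    and char: "\<And>f. cyl_char \<beta> f = exp (of_real c * (cyl_char \<alpha> f - 1))"
    and C: "C \<in> cylindrical_sets"
  shows "\<alpha> C \<le> ennreal (exp c / c) * \<beta> C"
proof -
  obtain n f B where B: "B \<in> sets (\<Pi>\<^sub>M i\<in>{..<n::nat}. (borel :: real measure))"
    and C_def: "C = {v. (\<lambda>i\<in>{..<n}. blinfun_apply (f i) v) \<in> B}"
    using C unfolding cylindrical_sets_def by blast
  let ?M = "cyl_restrict \<alpha> (f ` {..<n})"
  interpret additive_prob_space ?M using \<alpha> by (rule additive_prob_space_cyl_restrict) simp
  have f: "blinfun_apply (f i) \<in> borel_measurable ?M" if "i < n" for i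
    using that by (intro measurable_cyl_restrict) simp
  have comb: "blinfun_apply (\<Sum>i<n. t i *\<^sub>R f i) \<in> borel_measurable ?M" for t
    using f by (simp add: blinfun.sum_left blinfun.scaleR_left cong: measurable_cong)
  have "emeasure (compound_poisson c ?M) C = \<beta> C"
    unfolding C_def
  proof (rule cylindrical_measure_determined_by_char[OF \<beta> _ _ _ _ B])
    show "finite_measure (compound_poisson c ?M)"
      by (rule prob_space.finite_measure[OF prob_space_compound_poisson])
    show "blinfun_apply (f i) \<in> borel_measurable (compound_poisson c ?M)" if "i < n" for i
      using f[OF that] by (simp cong: measurable_cong_sets)
    fix t :: "nat \<Rightarrow> real"
    let ?g = "\<Sum>i<n. t i *\<^sub>R f i"
    have "(LINT v|compound_poisson c ?M. iexp (blinfun_apply ?g v)) = exp (of_real c * ((LINT v|?M. iexp (blinfun_apply ?g v)) - 1))"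
      by (rule char_compound_poisson[OF c comb]) (simp_all only: blinfun.add_right blinfun.zero_right)
    also have "\<dots> = cyl_char \<beta> ?g"
      using \<alpha> comb by (subst cyl_char_eq_integral_cyl_restrict) (simp_all add: char)
    finally show "(LINT v|compound_poisson c ?M. iexp (blinfun_apply ?g v)) = cyl_char \<beta> ?g" .
  qed simp
  moreover have "C \<in> functional_sigma (f ` {..<n})"
    unfolding C_def by (rule cylinder_in_functional_sigma[OF B])
  ultimately show ?thesis
    using emeasure_le_compound_poisson[OF c, of C] cylindrical_measure_space[OF \<alpha>]
    by (simp add: emeasure_cyl_restrict)
qed

lemma compound_poisson_extends:
  fixes \<alpha> \<beta> :: "'v::{real_normed_vector, second_countable_topology} set \<Rightarrow> ennreal"
  assumes \<alpha>: "cylindrical_measure \<alpha>" and \<beta>: "cylindrical_measure \<beta>" and c: "0 < c"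
    and char: "\<And>f. cyl_char \<beta> f = exp (of_real c * (cyl_char \<alpha> f - 1))"
    and \<mu>: "prob_space \<mu>" "sets \<mu> = sets borel"
    and ext: "\<And>C. C \<in> cylindrical_sets \<Longrightarrow> emeasure \<mu> C = \<alpha> C"
    and C: "C \<in> cylindrical_sets"
  shows "emeasure (compound_poisson c \<mu>) C = \<beta> C"
proof -
  interpret additive_prob_space \<mu> by (rule additive_prob_space_borel[OF \<mu>(2,1)])
  have meas: "blinfun_apply f \<in> borel_measurable \<mu>" for f
    using measurable_blinfun_apply_borel[of f] \<mu>(2) by (simp cong: measurable_cong_sets)
  have char_\<mu>: "(LINT v|\<mu>. iexp (blinfun_apply f v)) = cyl_char \<alpha> f" for f
  proof (rule cyl_char_eq[OF cylindrical_measure_space[OF \<alpha>] meas])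
    fix B :: "real set" assume "B \<in> sets borel"
    then have "blinfun_apply f -` B \<in> cylindrical_sets"
      using vimage_in_functional_sigma[of f "{f}" B] functional_sigma_subset_cylindrical_sets[of "{f}"] by auto
    then show "emeasure \<mu> (blinfun_apply f -` B \<inter> space \<mu>) = \<alpha> (blinfun_apply f -` B)"
      by (simp add: ext)
  qed simp
  obtain n f B where B: "B \<in> sets (\<Pi>\<^sub>M i\<in>{..<n::nat}. (borel :: real measure))"
    and C_def: "C = {v. (\<lambda>i\<in>{..<n}. blinfun_apply (f i) v) \<in> B}"
    using C unfolding cylindrical_sets_def by blast
  show ?thesis
    unfolding C_def
  proof (rule cylindrical_measure_determined_by_char[OF \<beta> _ _ _ _ B])
    show "finite_measure (compound_poisson c \<mu>)"
      by (rule prob_space.finite_measure[OF prob_space_compound_poisson])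
    show "blinfun_apply (f i) \<in> borel_measurable (compound_poisson c \<mu>)" for i
      using meas by (simp cong: measurable_cong_sets)
    fix t :: "nat \<Rightarrow> real"
    let ?g = "\<Sum>i<n. t i *\<^sub>R f i"
    have "(LINT v|compound_poisson c \<mu>. iexp (blinfun_apply ?g v)) = exp (of_real c * ((LINT v|\<mu>. iexp (blinfun_apply ?g v)) - 1))"
      by (rule char_compound_poisson[OF c meas]) (simp_all only: blinfun.add_right blinfun.zero_right)
    then show "(LINT v|compound_poisson c \<mu>. iexp (blinfun_apply ?g v)) = cyl_char \<beta> ?g"
      by (simp only: char_\<mu> char)
  qed simp
qed

lemma additive_cylindrical_measure:
  assumes \<alpha>: "cylindrical_measure \<alpha>"
  shows "additive cylindrical_sets \<alpha>"
  unfolding additive_def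
proof safe
  fix C D :: "'a set" assume CD: "C \<in> cylindrical_sets" "D \<in> cylindrical_sets" "C \<inter> D = {}"
  then obtain \<Gamma> \<Delta> where \<Gamma>: "finite \<Gamma>" "C \<in> functional_sigma \<Gamma>" and \<Delta>: "finite \<Delta>" "D \<in> functional_sigma \<Delta>"
    by (auto simp: cylindrical_sets_iff)
  let ?M = "cyl_restrict \<alpha> (\<Gamma> \<union> \<Delta>)"
  have sets: "C \<in> sets ?M" "D \<in> sets ?M"
    using \<Gamma> \<Delta> functional_sigma_mono[of \<Gamma> "\<Gamma> \<union> \<Delta>"] functional_sigma_mono[of \<Delta> "\<Gamma> \<union> \<Delta>"] by auto
  have "C \<union> D \<in> sets ?M" using sets by (rule sets.Un)
  with plus_emeasure[OF sets CD(3)] sets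
  show "\<alpha> (C \<union> D) = \<alpha> C + \<alpha> D"
    using \<Gamma>(1) \<Delta>(1) cylindrical_measure_space[OF \<alpha>] by (simp add: emeasure_cyl_restrict)
qed

text \<open>
  The extension is \<open>density \<rho> f\<close> with \<open>f \<le> K\<close>. Being a density with respect to \<open>\<rho>\<close>, it is a measure on
  all Borel sets at once, and not merely on the \<open>\<sigma>\<close>-algebra generated by the cylindrical sets; the bound
  on \<open>f\<close> controls every integral, in particular the moments.
\<close>

lemma dominated_cylindrical_measure_extends:
  assumes \<alpha>: "cylindrical_measure \<alpha>" and \<rho>: "finite_measure \<rho>" "sets \<rho> = sets borel"
    and dom: "\<And>C. C \<in> cylindrical_sets \<Longrightarrow> \<alpha> C \<le> K * emeasure \<rho> C" and K: "K < top"
  shows "\<exists>\<mu>. prob_space \<mu> \<and> sets \<mu> = sets borel \<and> (\<forall>C\<in>cylindrical_sets. emeasure \<mu> C = \<alpha> C) \<and>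
    (\<forall>g\<in>borel_measurable borel. (\<integral>\<^sup>+v. g v \<partial>\<mu>) \<le> K * (\<integral>\<^sup>+v. g v \<partial>\<rho>))"
proof -
  have sp: "space \<rho> = UNIV" using sets_eq_imp_space_eq[OF \<rho>(2)] by simp
  have "positive cylindrical_sets \<alpha>"
    using cylindrical_measure_space[OF \<alpha>, of "{}"] by (simp add: measure_space_def positive_def)
  then have "\<exists>f\<in>borel_measurable \<rho>. (\<forall>v. f v \<le> K) \<and> (\<forall>C\<in>cylindrical_sets. emeasure (density \<rho> f) C = \<alpha> C)"
    using algebra_cylindrical_sets cylindrical_sets_subset_borel additive_cylindrical_measure[OF \<alpha>] dom K
    by (intro dominated_additive_has_density[OF \<rho>(1)]) (simp_all add: sp \<rho>(2))
  then obtain f where f: "f \<in> borel_measurable \<rho>" "\<And>v. f v \<le> K"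
    "\<And>C. C \<in> cylindrical_sets \<Longrightarrow> emeasure (density \<rho> f) C = \<alpha> C"
    by blast
  have UNIV_cyl: "UNIV \<in> cylindrical_sets"
    using functional_sigma_subset_cylindrical_sets[of "{}"] UNIV_in_functional_sigma by blast
  have "prob_space (density \<rho> f)"
    by (rule prob_spaceI) (use f(3)[OF UNIV_cyl] \<alpha> in \<open>simp add: sp cylindrical_measure_def\<close>)
  moreover have "(\<integral>\<^sup>+v. g v \<partial>density \<rho> f) \<le> K * (\<integral>\<^sup>+v. g v \<partial>\<rho>)" if "g \<in> borel_measurable borel" for g
  proof -
    have g: "g \<in> borel_measurable \<rho>" using that \<rho>(2) by (simp cong: measurable_cong_sets)
    have "(\<integral>\<^sup>+v. g v \<partial>density \<rho> f) = (\<integral>\<^sup>+v. f v * g v \<partial>\<rho>)" by (rule nn_integral_density[OF f(1) g])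
    also have "\<dots> \<le> (\<integral>\<^sup>+v. K * g v \<partial>\<rho>)" by (intro nn_integral_mono mult_right_mono f) simp
    also have "\<dots> = K * (\<integral>\<^sup>+v. g v \<partial>\<rho>)" using g by (rule nn_integral_cmult)
    finally show ?thesis .
  qed
  ultimately show ?thesis
    using f(3) \<rho>(2) by (intro exI[of _ "density \<rho> f"]) simp
qed

section \<open>Radonifying operators\<close>

text \<open>
  The representing vector minimises the quadratic functional \<open>J x = norm x ^ 2 / 2 - f x\<close>. By the
  parallelogram law \<open>norm (x - y) ^ 2 / 4 = J x + J y - 2 * J ((x + y) / 2)\<close>, so a minimising sequence
  is Cauchy; and at a minimiser \<open>z\<close> the derivative \<open>z \<bullet> h - f h\<close> in each direction \<open>h\<close> vanishes.
\<close>

lemma riesz_representation: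
  fixes f :: "'h::{real_inner, banach} \<Rightarrow>\<^sub>L real"
  shows "\<exists>y. f = blinfun_inner_right y"
proof -
  define J where "J x = (norm x)\<^sup>2 / 2 - blinfun_apply f x" for x
  have lower: "- (norm f)\<^sup>2 / 2 \<le> J x" for x
  proof -
    have "blinfun_apply f x \<le> norm f * norm x"
      using norm_blinfun[of f x] by simp
    moreover have "0 \<le> (norm x - norm f)\<^sup>2" by simp
    ultimately show ?thesis by (simp add: J_def power2_diff field_simps)
  qed
  then have bdd: "bdd_below (range J)" by (auto intro!: bdd_belowI)
  define I where "I = (INF x. J x)"
  have I_le: "I \<le> J x" for x unfolding I_def by (rule cINF_lower[OF bdd]) simp
  have "\<exists>x. J x < I + 1 / Suc n" for n
    using cINF_less_iff[of UNIV J "I + 1 / Suc n"] bdd by (simp add: I_def)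
  then obtain X where X: "\<And>n. J (X n) < I + 1 / Suc n" by metis
  have par: "(norm (x - y))\<^sup>2 / 4 = J x + J y - 2 * J ((1/2) *\<^sub>R (x + y))" for x y
    by (simp add: J_def blinfun.scaleR_right blinfun.add_right power2_norm_eq_inner
        inner_diff_left inner_diff_right inner_add_left inner_add_right inner_commute field_simps)
  have "Cauchy X"
  proof (rule metric_CauchyI)
    fix e :: real assume e: "0 < e"
    obtain k :: nat where k: "8 / e\<^sup>2 < real k" using reals_Archimedean2 by blast
    have "dist (X m) (X n) < e" if "m \<ge> k" "n \<ge> k" for m n
    proof -
      have small: "1 / real (Suc i) < e\<^sup>2 / 8" if "i \<ge> k" for i
      proof -
        have "8 / e\<^sup>2 < real (Suc i)" using k that by linarith
        then show ?thesis using e by (simp add: field_simps)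
      qed
      have "(norm (X m - X n))\<^sup>2 / 4 < (I + 1 / Suc m) + (I + 1 / Suc n) - 2 * I"
        using X[of m] X[of n] I_le[of "(1/2) *\<^sub>R (X m + X n)"] unfolding par by linarith
      also have "\<dots> < e\<^sup>2 / 4" using small[OF that(1)] small[OF that(2)] by linarith
      finally have "(norm (X m - X n))\<^sup>2 < e\<^sup>2" by simp
      then show ?thesis using e by (simp add: dist_norm power_less_imp_less_base)
    qed
    then show "\<exists>M. \<forall>m\<ge>M. \<forall>n\<ge>M. dist (X m) (X n) < e" by blast
  qed
  then obtain z where z: "X \<longlonglongrightarrow> z" using Cauchy_convergent convergent_def by blast
  have "(\<lambda>n. J (X n)) \<longlonglongrightarrow> J z" unfolding J_def by (intro tendsto_intros z) simp
  moreover have "(\<lambda>n. I + 1 / Suc n) \<longlonglongrightarrow> I + 0"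
    by (intro tendsto_add tendsto_const LIMSEQ_Suc lim_1_over_n)
  moreover have "\<forall>n\<ge>0. J (X n) \<le> I + 1 / Suc n" using X less_imp_le by blast
  ultimately have "J z \<le> I + 0" by (rule LIMSEQ_le[OF _ _ exI])
  then have min: "J z \<le> J w" for w using I_le[of w] by linarith
  have "blinfun_apply f h = z \<bullet> h" for h
  proof -
    define a b where "a = z \<bullet> h - blinfun_apply f h" and "b = (norm h)\<^sup>2 / 2"
    have b0: "0 \<le> b" by (simp add: b_def)
    have ineq: "0 \<le> t * a + t\<^sup>2 * b" for t
    proof -
      have "J (z + t *\<^sub>R h) = J z + (t * a + t\<^sup>2 * b)"
        by (simp add: J_def a_def b_def blinfun.scaleR_right blinfun.add_right power2_norm_eq_inner
            inner_add_left inner_add_right inner_commute power2_eq_square[of t] field_simps)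
      then show ?thesis using min[of "z + t *\<^sub>R h"] by linarith
    qed
    \<comment> \<open>The step \<open>t = - s * a\<close> would give a negative value unless \<open>a = 0\<close>.\<close>
    define s where "s = 1 / (2 * b + 1)"
    have s: "0 < s" "s * b - 1 < 0" using b0 by (simp_all add: s_def field_simps)
    have "0 \<le> (s * a\<^sup>2) * (s * b - 1)"
      using ineq[of "- s * a"] by (simp add: power2_eq_square algebra_simps)
    then have "\<not> 0 < s * a\<^sup>2" using s(2) mult_pos_neg[of "s * a\<^sup>2" "s * b - 1"] by linarith
    then have "a = 0" using s(1) by (simp add: zero_less_mult_iff)
    then show ?thesis by (simp add: a_def)
  qed
  then have "f = blinfun_inner_right z" by (intro blinfun_eqI) simp
  then show ?thesis ..
qed

theorem theorem4p11:
  fixes \<nu> \<theta> :: "'h::{real_inner, banach, second_countable_topology} set \<Rightarrow> ennreal"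
    and c p :: real
  assumes "cylindrical_prob \<nu>"
    and "c > 0"
    and "compound_poisson_cylindrical c \<nu> \<theta>"
    and "p \<ge> 1"
  shows "(radonifying_ops p \<theta> :: ('h \<Rightarrow>\<^sub>L 'v::{banach, second_countable_topology}) set)
         = radonifying_ops p \<nu>"
proof -
  have \<nu>: "cylindrical_measure \<nu>" and \<theta>: "cylindrical_measure \<theta>"
    using assms(1,3) by (auto simp: cylindrical_measure_def cylindrical_prob_def compound_poisson_cylindrical_def)
  \<comment> \<open>The hypothesis speaks of functionals \<open>h \<bullet> _\<close>; by the Riesz theorem these are all functionals, in particular all \<open>f \<circ> T\<close>.\<close>
  have char_\<theta>: "cyl_char \<theta> f = exp (of_real c * (cyl_char \<nu> f - 1))" for f
  proof -
    obtain h where f: "f = blinfun_inner_right h" using riesz_representation by blast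
    let ?M = "cyl_restrict \<nu> {blinfun_inner_right h}"
    interpret M: prob_space ?M by (rule prob_space_cyl_restrict[OF \<nu>]) simp
    have [measurable]: "(\<lambda>g. h \<bullet> g) \<in> borel_measurable ?M"
      using measurable_cyl_restrict[of "blinfun_inner_right h" "{blinfun_inner_right h}" \<nu>] by simp
    have "integrable ?M (\<lambda>g. iexp (h \<bullet> g))" by (rule M.integrable_const_bound[where B=1]) auto
    then have "(LINT g|?M. (iexp (h \<bullet> g) - 1)) = cyl_char \<nu> f - 1"
      using M.prob_space by (simp add: f cyl_char_def)
    then show ?thesis using assms(3) by (simp add: f compound_poisson_cylindrical_def)
  qed
  have "radonifying p \<theta> T \<longleftrightarrow> radonifying p \<nu> T" for T :: "'h \<Rightarrow>\<^sub>L 'v"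
  proof -
    let ?\<alpha> = "cyl_image \<nu> T" and ?\<beta> = "cyl_image \<theta> T"
    note \<alpha> = cylindrical_measure_cyl_image[OF \<nu>, of T] and \<beta> = cylindrical_measure_cyl_image[OF \<theta>, of T]
    have char: "cyl_char ?\<beta> f = exp (of_real c * (cyl_char ?\<alpha> f - 1))" for f
      by (simp add: cyl_char_cyl_image \<nu> \<theta> char_\<theta>)
    show ?thesis
    proof
      assume "radonifying p \<nu> T"
      then obtain \<mu> :: "'v measure" where \<mu>: "prob_space \<mu>" "sets \<mu> = sets borel"
        "\<And>C. C \<in> cylindrical_sets \<Longrightarrow> emeasure \<mu> C = ?\<alpha> C"
        "(\<integral>\<^sup>+v. ennreal (norm v powr p) \<partial>\<mu>) < \<infinity>"
        unfolding radonifying_def by blast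
      interpret additive_prob_space \<mu> by (rule additive_prob_space_borel[OF \<mu>(2,1)])
      have "(\<integral>\<^sup>+v. ennreal (norm v powr p) \<partial>compound_poisson c \<mu>) < \<infinity>"
        using assms(2,4) \<mu> by (intro moment_compound_poisson_finite) auto
      then show "radonifying p \<theta> T"
        unfolding radonifying_def
        using prob_space_compound_poisson compound_poisson_extends[OF \<alpha> \<beta> assms(2) char \<mu>(1,2,3)] \<mu>(2)
        by (intro exI[of _ "compound_poisson c \<mu>"]) auto
    next
      assume "radonifying p \<theta> T"
      then obtain \<rho> :: "'v measure" where \<rho>: "prob_space \<rho>" "sets \<rho> = sets borel"
        "\<And>C. C \<in> cylindrical_sets \<Longrightarrow> emeasure \<rho> C = ?\<beta> C"
        "(\<integral>\<^sup>+v. ennreal (norm v powr p) \<partial>\<rho>) < \<infinity>"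
        unfolding radonifying_def by blast
      let ?K = "ennreal (exp c / c)"
      obtain \<mu> where \<mu>: "prob_space \<mu>" "sets \<mu> = sets borel"
        "\<And>C. C \<in> cylindrical_sets \<Longrightarrow> emeasure \<mu> C = ?\<alpha> C"
        "\<And>g. g \<in> borel_measurable borel \<Longrightarrow> (\<integral>\<^sup>+v. g v \<partial>\<mu>) \<le> ?K * (\<integral>\<^sup>+v. g v \<partial>\<rho>)"
        using dominated_cylindrical_measure_extends[OF \<alpha> prob_space.finite_measure[OF \<rho>(1)] \<rho>(2), of ?K]
          cylindrical_measure_le_compound_poisson[OF \<alpha> \<beta> assms(2) char] \<rho>(3)
        by auto
      have "(\<integral>\<^sup>+v. ennreal (norm v powr p) \<partial>\<mu>) \<le> ?K * (\<integral>\<^sup>+v. ennreal (norm v powr p) \<partial>\<rho>)"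
        by (rule \<mu>(4)) measurable
      also have "\<dots> < \<infinity>" using \<rho>(4) by (simp add: ennreal_mult_less_top)
      finally show "radonifying p \<nu> T" unfolding radonifying_def using \<mu> by blast
    qed
  qed
  then show ?thesis by (simp add: radonifying_ops_def)
qed

end
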